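(* If $\alpha$ is a left-c.e. real which is neither computable nor Martin-Löf random, then there exists a left-c.e. real $\beta$, which is also not Martin-Löf random, such that $\alpha-\beta$ is neither a left-c.e. real nor a right-c.e. real.
   Context: A real $x$ is left-c.e. if its left Dedekind cut $\{q\in\mathbb{Q}: q<x\}$ is computably enumerable (equivalently, $x$ is the limit of a computable non-decreasing sequence of rationals). A real $x$ is right-c.e. if its right Dedekind cut $\{q\in\mathbb{Q}: q>x\}$ is computably enumerable (equivalently, $x$ is the limit of a computable non-increasing sequence of rationals). Martin-Löf randomness of a real is with respect to Lebesgue measure (equivalently, Martin-Löf randomness of the binary expansion of its fractional part with respect to the uniform measure on Cantor space). *)

theory Defs
  imports "HOL-Analysis.Analysis" "HOL-Library.Countable" "HOL-Library.Nat_Bijection"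
begin

section \<open>Partial recursive functions\<close>

text \<open>
  Kleene's schemes. Programs carry no arity; a program applied to an argument list of an
  unsuitable length simply diverges. In \<open>PrimRec\<close> the recursion argument, and in \<open>Mu\<close> the
  search argument, is the head of the list.
\<close>

datatype recf =
    Zero
  | Succ
  | Proj nat
  | Comp recf "recf list"
  | PrimRec recf recf
  | Mu recf

text \<open>\<open>rec_eval f xs y\<close>: the program \<open>f\<close> halts on input \<open>xs\<close> with output \<open>y\<close>.\<close>

inductive rec_eval :: "recf \<Rightarrow> nat list \<Rightarrow> nat \<Rightarrow> bool" where
  eval_Zero: "rec_eval Zero xs 0"
| eval_Succ: "rec_eval Succ [x] (Suc x)"
| eval_Proj: "i < length xs \<Longrightarrow> rec_eval (Proj i) xs (xs ! i)"
| eval_Comp: "list_all2 (\<lambda>g y. rec_eval g xs y) gs ys \<Longrightarrow> rec_eval f ys z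
    \<Longrightarrow> rec_eval (Comp f gs) xs z"
| eval_PrimRec_0: "rec_eval f xs z \<Longrightarrow> rec_eval (PrimRec f g) (0 # xs) z"
| eval_PrimRec_Suc: "rec_eval (PrimRec f g) (n # xs) y \<Longrightarrow> rec_eval g (n # y # xs) z
    \<Longrightarrow> rec_eval (PrimRec f g) (Suc n # xs) z"
| eval_Mu: "rec_eval f (n # xs) 0 \<Longrightarrow> (\<forall>m<n. \<exists>y. rec_eval f (m # xs) (Suc y))
    \<Longrightarrow> rec_eval (Mu f) xs n"

lemma rec_eval_deterministic: "rec_eval f xs y \<Longrightarrow> rec_eval f xs z \<Longrightarrow> y = z"
proof (induction arbitrary: z rule: rec_eval.induct)
  case (eval_Comp xs gs ys f w)
  from eval_Comp.prems obtain us where us: "list_all2 (\<lambda>g y. rec_eval g xs y) gs us"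
    and f: "rec_eval f us z"
    by (cases rule: rec_eval.cases) auto
  have "ys = us"
    using eval_Comp.IH(1) us by (auto simp: list_all2_conv_all_nth intro!: nth_equalityI)
  then show ?case using f eval_Comp.IH(2) by blast
next
  case (eval_PrimRec_Suc f g n xs y w)
  from eval_PrimRec_Suc.prems show ?case
    by (cases rule: rec_eval.cases) (use eval_PrimRec_Suc.IH in blast)
next
  case (eval_Mu f n xs)
  from eval_Mu.prems have 0: "rec_eval f (z # xs) 0"
    and lt: "\<forall>m<z. \<exists>y. rec_eval f (m # xs) (Suc y)"
    by (cases rule: rec_eval.cases; simp)+
  have "\<not> z < n" using eval_Mu.IH(2) 0 by (metis nat.distinct(1))
  moreover have "\<not> n < z" using eval_Mu.IH(1) lt by (metis nat.distinct(1))
  ultimately show ?case by simp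
qed (erule rec_eval.cases; simp)+

definition computable_fun :: "(nat \<Rightarrow> nat) \<Rightarrow> bool" where
  "computable_fun f \<longleftrightarrow> (\<exists>e. \<forall>n. rec_eval e [n] (f n))"

definition ce_set :: "nat set \<Rightarrow> bool" where
  "ce_set A \<longleftrightarrow> (\<exists>e. A = {n. \<exists>y. rec_eval e [n] y})"


section \<open>Effective notions for real numbers\<close>

text \<open>
  Pairs are coded by the library's Cantor pairing \<^const>\<open>prod_encode\<close>, and rationals by the
  library's surjection \<^const>\<open>nat_to_rat_surj\<close>, which sends \<open>prod_encode (a, b)\<close> to the fraction
  with numerator \<open>int_decode a\<close> and denominator \<open>int_decode b\<close> (and to 0 if the latter is 0).
  A set of rationals is computably enumerable iff its set of codes is.
\<close>

abbreviation rat_real :: "nat \<Rightarrow> real" where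
  "rat_real n \<equiv> of_rat (nat_to_rat_surj n)"

definition ce_rat_set :: "rat set \<Rightarrow> bool" where
  "ce_rat_set Q \<longleftrightarrow> ce_set {n. nat_to_rat_surj n \<in> Q}"

definition left_ce :: "real \<Rightarrow> bool" where
  "left_ce x \<longleftrightarrow> ce_rat_set {q. of_rat q < x}"

definition right_ce :: "real \<Rightarrow> bool" where
  "right_ce x \<longleftrightarrow> ce_rat_set {q. of_rat q > x}"

definition computable_real :: "real \<Rightarrow> bool" where
  "computable_real x \<longleftrightarrow>
    (\<exists>f. computable_fun f \<and> (\<forall>n. \<bar>x - rat_real (f n)\<bar> \<le> 1 / 2 ^ n))"

text \<open>
  A set \<open>W\<close> of coded triples \<open>(n, i, j)\<close> describes a sequence of open sets of reals, the \<open>n\<close>-th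
  being the union of the rational intervals whose codes are listed for \<open>n\<close>. For computably
  enumerable \<open>W\<close> these are exactly the uniformly effectively open sequences.
\<close>

definition coded_open :: "nat set \<Rightarrow> nat \<Rightarrow> real set" where
  "coded_open W n =
    (\<Union>(i, j) \<in> {(i, j). prod_encode (n, prod_encode (i, j)) \<in> W}. {rat_real i<..<rat_real j})"

definition martin_loef_test :: "(nat \<Rightarrow> real set) \<Rightarrow> bool" where
  "martin_loef_test U \<longleftrightarrow>
    (\<exists>W. ce_set W \<and> U = coded_open W) \<and> (\<forall>n. emeasure lborel (U n) \<le> ennreal (1 / 2 ^ n))"

definition martin_loef_random :: "real \<Rightarrow> bool" where
  "martin_loef_random x \<longleftrightarrow> (\<forall>U. martin_loef_test U \<longrightarrow> x \<notin> (\<Inter>n. U n))"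

end

theory Submission
  imports Defs
begin

text \<open>
  Requirement \<open>2 e\<close> keeps the \<open>e\<close>-th computably enumerable set from being the left cut of
  \<open>\<alpha> - \<beta>\<close>, and requirement \<open>2 e + 1\<close> keeps it from being the right cut; \<open>\<beta>\<close> is built by a
  finite injury argument. A requirement acts when the set looks like the cut with a precision that
  doubles at each action. An even requirement then raises \<open>\<beta>\<close> by twice the increase of \<open>\<alpha>\<close>
  since its last action, an odd one only restrains the requirements of lower priority. If a
  requirement acted infinitely often, its set would really be the cut, and this would bound the
  distance from \<open>\<alpha>\<close> to its approximation at each action, so that \<open>\<alpha>\<close> would be computable.

  The even requirements are compatible with the restraints because \<open>\<alpha>\<close> is not random: a
  requirement raises \<open>\<beta>\<close> only while the approximation of \<open>\<alpha>\<close> moves inside a component \<open>U n\<close>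
  of a test that captures \<open>\<alpha>\<close>, which costs at most \<open>2 / 2 ^ n\<close>, and \<open>n\<close> is increased with
  each action of a requirement of higher priority. The same bound puts \<open>\<beta>\<close> into small balls
  around its approximations that form a test, so \<open>\<beta>\<close> is not random either.
\<close>

section \<open>Computable functions\<close>

lemma eval_Comp1: "rec_eval g xs y \<Longrightarrow> rec_eval f [y] z \<Longrightarrow> rec_eval (Comp f [g]) xs z"
  by (rule eval_Comp[where ys = "[y]"]) auto

lemma eval_Comp2:
  "rec_eval g xs y \<Longrightarrow> rec_eval h xs z \<Longrightarrow> rec_eval f [y, z] w \<Longrightarrow> rec_eval (Comp f [g, h]) xs w"
  by (rule eval_Comp[where ys = "[y, z]"]) auto

lemma eval_Proj_0: "rec_eval (Proj 0) (x # xs) x"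
  using eval_Proj[of 0 "x # xs"] by simp

lemma eval_Proj_1: "rec_eval (Proj 1) (x # y # xs) y"
  using eval_Proj[of 1 "x # y # xs"] by simp

lemma eval_Proj_2: "rec_eval (Proj 2) (x # y # z # xs) z"
  using eval_Proj[of 2 "x # y # z # xs"] by simp

section \<open>Programs for arithmetic and for the Cantor pairing\<close>

definition "add_prog = PrimRec (Proj 0) (Comp Succ [Proj 1])"
definition "sub_prog = PrimRec (Proj 0) (Comp (PrimRec Zero (Proj 0)) [Proj 1])"
definition "triangle_prog = PrimRec Zero (Comp Succ [Comp add_prog [Proj 0, Proj 1]])"
definition "pair_prog = Comp add_prog [Comp triangle_prog [add_prog], Proj 0]"
text \<open>Inverts the pairing: the least \<open>m\<close> with \<open>n < triangle (Suc m)\<close>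
  is the sum of the two coded components. \<open>sub_prog\<close> takes the subtrahend first, so the
  body vanishes exactly when this inequality holds.\<close>

definition "diag_prog =
  Mu (Comp sub_prog [Comp triangle_prog [Comp Succ [Proj 0]], Comp Succ [Proj 1]])"
definition "fst_prog = Comp sub_prog [Comp triangle_prog [diag_prog], Proj 0]"
definition "snd_prog = Comp sub_prog [fst_prog, diag_prog]"

lemma eval_add_prog: "rec_eval add_prog [m, n] (m + n)"
proof (induction m)
  case 0
  show ?case unfolding add_prog_def by (auto intro!: eval_PrimRec_0 eval_Proj_0)
next
  case (Suc m)
  then show ?case unfolding add_prog_def
    using eval_PrimRec_Suc[OF _ eval_Comp1[OF eval_Proj_1 eval_Succ], of "Proj 0" m "[n]" "m + n"]
    by simp
qed

lemma eval_pred: "rec_eval (PrimRec Zero (Proj 0)) [n] (n - 1)"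
proof (induction n)
  case 0
  show ?case by (auto intro!: eval_PrimRec_0 eval_Zero)
next
  case (Suc n)
  then show ?case by (auto intro!: eval_PrimRec_Suc[where y = "n - 1"] eval_Proj_0)
qed

lemma eval_sub_prog: "rec_eval sub_prog [m, n] (n - m)"
proof (induction m)
  case 0
  show ?case unfolding sub_prog_def by (auto intro!: eval_PrimRec_0 eval_Proj_0)
next
  case (Suc m)
  have "rec_eval (Comp (PrimRec Zero (Proj 0)) [Proj 1]) [m, n - m, n] (n - Suc m)"
    using eval_Comp1[OF eval_Proj_1 eval_pred, of m "n - m" "[n]"] by simp
  with Suc show ?case unfolding sub_prog_def
    by (auto intro!: eval_PrimRec_Suc[where y = "n - m"])
qed

lemma eval_triangle_prog: "rec_eval triangle_prog [n] (triangle n)"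
proof (induction n)
  case 0
  show ?case unfolding triangle_prog_def by (auto intro!: eval_PrimRec_0 eval_Zero)
next
  case (Suc n)
  have "rec_eval (Comp Succ [Comp add_prog [Proj 0, Proj 1]]) [n, triangle n] (triangle (Suc n))"
    using eval_Comp1[OF eval_Comp2[OF eval_Proj_0 eval_Proj_1 eval_add_prog] eval_Succ,
        of n "triangle n" "[]"]
    by (simp add: add.commute)
  with Suc show ?case unfolding triangle_prog_def
    by (auto intro!: eval_PrimRec_Suc[where y = "triangle n"])
qed

lemma eval_pair_prog: "rec_eval pair_prog [m, n] (prod_encode (m, n))"
  unfolding pair_prog_def prod_encode_def prod.case
  by (rule eval_Comp2 eval_Comp1 eval_add_prog eval_triangle_prog eval_Proj_0)+

lemma triangle_mono: "m \<le> n \<Longrightarrow> triangle m \<le> triangle n"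
  by (rule lift_Suc_mono_le[of triangle]) auto

lemma eval_diag_prog: "rec_eval diag_prog [prod_encode (a, b)] (a + b)"
proof -
  let ?n = "prod_encode (a, b)"
  have body: "rec_eval (Comp sub_prog [Comp triangle_prog [Comp Succ [Proj 0]], Comp Succ [Proj 1]])
      [m, ?n] (Suc ?n - triangle (Suc m))" for m
    by (rule eval_Comp2 eval_Comp1 eval_sub_prog eval_triangle_prog eval_Succ eval_Proj_0
        eval_Proj_1)+
  have 0: "Suc ?n - triangle (Suc (a + b)) = 0"
    by (simp add: prod_encode_def)
  have pos: "\<exists>y. Suc ?n - triangle (Suc m) = Suc y" if "m < a + b" for m
  proof -
    have "triangle (Suc m) \<le> ?n"
      using triangle_mono[of "Suc m" "a + b"] that by (simp add: prod_encode_def)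
    then show ?thesis by (intro exI[of _ "?n - triangle (Suc m)"]) (simp del: triangle_Suc)
  qed
  show ?thesis unfolding diag_prog_def
  proof (rule eval_Mu)
    show "rec_eval (Comp sub_prog [Comp triangle_prog [Comp Succ [Proj 0]], Comp Succ [Proj 1]])
        [a + b, ?n] 0"
      using body[of "a + b"] 0 by simp
    show "\<forall>m<a + b. \<exists>y. rec_eval (Comp sub_prog [Comp triangle_prog [Comp Succ [Proj 0]],
        Comp Succ [Proj 1]]) [m, ?n] (Suc y)"
      using body pos by metis
  qed
qed

lemma eval_fst_prog: "rec_eval fst_prog [n] (fst (prod_decode n))"
proof -
  obtain a b where n: "n = prod_encode (a, b)" by (metis prod_decode_inverse surj_pair)
  have "rec_eval fst_prog [prod_encode (a, b)] (prod_encode (a, b) - triangle (a + b))"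
    unfolding fst_prog_def
    by (rule eval_Comp2 eval_Comp1 eval_sub_prog eval_triangle_prog eval_diag_prog eval_Proj_0)+
  then show ?thesis by (simp add: n) (simp add: prod_encode_def)
qed

lemma eval_snd_prog: "rec_eval snd_prog [n] (snd (prod_decode n))"
proof -
  obtain a b where n: "n = prod_encode (a, b)" by (metis prod_decode_inverse surj_pair)
  have "rec_eval snd_prog [prod_encode (a, b)] (a + b - fst (prod_decode (prod_encode (a, b))))"
    unfolding snd_prog_def
    by (rule eval_Comp2 eval_sub_prog eval_diag_prog eval_fst_prog)+
  then show ?thesis by (simp add: n)
qed

lemma computable_fun_id: "computable_fun (\<lambda>n. n)"
  unfolding computable_fun_def using eval_Proj_0 by blast

lemma computable_fun_const: "computable_fun (\<lambda>_. c)"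
proof (induction c)
  case 0
  show ?case unfolding computable_fun_def using eval_Zero by blast
next
  case (Suc c)
  then show ?case unfolding computable_fun_def using eval_Comp1[OF _ eval_Succ] by metis
qed

lemma computable_fun_Suc: "computable_fun Suc"
  unfolding computable_fun_def using eval_Succ by blast

lemma computable_fun_comp:
  "computable_fun f \<Longrightarrow> computable_fun g \<Longrightarrow> computable_fun (\<lambda>n. f (g n))"
  unfolding computable_fun_def using eval_Comp1 by metis

lemma computable_fun_fst: "computable_fun (\<lambda>n. fst (prod_decode n))"
  unfolding computable_fun_def using eval_fst_prog by blast

lemma computable_fun_snd: "computable_fun (\<lambda>n. snd (prod_decode n))"
  unfolding computable_fun_def using eval_snd_prog by blast

lemma computable_fun_pair:
  "computable_fun f \<Longrightarrow> computable_fun g \<Longrightarrow> computable_fun (\<lambda>n. prod_encode (f n, g n))"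
  unfolding computable_fun_def by (blast intro: eval_Comp2 eval_pair_prog)

text \<open>Since \<open>computable_fun\<close> is unary, the number of rounds and the parameter
  arrive as one coded pair, and the step function gets parameter, round and previous value as one
  coded triple.\<close>

lemma computable_fun_rec:
  assumes "computable_fun g" and "computable_fun h"
  shows "computable_fun (\<lambda>n. rec_nat (g (snd (prod_decode n)))
    (\<lambda>i r. h (prod_encode (snd (prod_decode n), prod_encode (i, r)))) (fst (prod_decode n)))"
proof -
  obtain eg eh where eg: "\<And>n. rec_eval eg [n] (g n)" and eh: "\<And>n. rec_eval eh [n] (h n)"
    using assms unfolding computable_fun_def by blast
  let ?step = "Comp eh [Comp pair_prog [Proj 2, Comp pair_prog [Proj 0, Proj 1]]]"
  have "rec_eval (PrimRec eg ?step) [m, x]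
      (rec_nat (g x) (\<lambda>i r. h (prod_encode (x, prod_encode (i, r)))) m)" (is "rec_eval _ _ (?r m)") for m x
  proof (induction m)
    case 0
    show ?case by (simp add: eval_PrimRec_0 eg)
  next
    case (Suc m)
    have "rec_eval ?step [m, ?r m, x] (?r (Suc m))"
      unfolding nat.rec
      by (rule eval_Comp1 eval_Comp2 eval_pair_prog eh eval_Proj_0 eval_Proj_1 eval_Proj_2)+
    with Suc show ?case by (rule eval_PrimRec_Suc)
  qed
  note rec = this
  have "rec_eval (Comp (PrimRec eg ?step) [fst_prog, snd_prog]) [n]
     (rec_nat (g (snd (prod_decode n)))
    (\<lambda>i r. h (prod_encode (snd (prod_decode n), prod_encode (i, r)))) (fst (prod_decode n)))" for n
    by (rule eval_Comp2[OF eval_fst_prog eval_snd_prog rec])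
  then show ?thesis unfolding computable_fun_def by blast
qed

text \<open>\<open>Mu\<close> looks for a zero, so the body computes 1 minus the truth value. The
  one program serves twice: its domain gives computably enumerable sets, its value gives least
  witnesses.\<close>

lemma eval_search:
  assumes "computable_fun (\<lambda>n. of_bool (P (fst (prod_decode n)) (snd (prod_decode n))))"
  obtains e where "\<And>x. (\<exists>y. rec_eval e [x] y) \<longleftrightarrow> (\<exists>s. P s x)"
    and "\<And>x. \<exists>s. P s x \<Longrightarrow> rec_eval e [x] (LEAST s. P s x)"
proof -
  obtain d where d: "\<And>n. rec_eval d [n] (of_bool (P (fst (prod_decode n)) (snd (prod_decode n))))"
    using assms unfolding computable_fun_def by blast
  let ?f = "Comp sub_prog [Comp d [pair_prog], Comp Succ [Zero]]"
  have f: "rec_eval ?f [s, x] (Suc 0 - of_bool (P s x))" for s x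
  proof -
    have "rec_eval d [prod_encode (s, x)] (of_bool (P s x))"
      using d[of "prod_encode (s, x)"] by simp
    then show ?thesis
      by (rule eval_Comp2[OF eval_Comp1[OF eval_pair_prog] eval_Comp1[OF eval_Zero eval_Succ]
            eval_sub_prog])
  qed
  have least: "rec_eval (Mu ?f) [x] (LEAST s. P s x)" if "\<exists>s. P s x" for x
  proof (rule eval_Mu)
    show "rec_eval ?f [LEAST s. P s x, x] 0"
      using f[of "LEAST s. P s x" x] LeastI_ex[OF that] by simp
    show "\<forall>m<LEAST s. P s x. \<exists>y. rec_eval ?f [m, x] (Suc y)"
    proof safe
      fix m assume "m < (LEAST s. P s x)"
      then have "\<not> P m x" by (rule not_less_Least)
      with f[of m x] show "\<exists>y. rec_eval ?f [m, x] (Suc y)" by auto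
    qed
  qed
  have "\<exists>s. P s x" if "rec_eval (Mu ?f) [x] y" for x y
  proof -
    from that have "rec_eval ?f [y, x] 0" by (cases rule: rec_eval.cases) auto
    then have "Suc 0 - of_bool (P y x) = 0" using f rec_eval_deterministic by blast
    then show ?thesis by (cases "P y x") auto
  qed
  with least that[of "Mu ?f"] show ?thesis by blast
qed

section \<open>Computability of functions between encodable types\<close>

class encodable =
  fixes enc :: "'a \<Rightarrow> nat"
  assumes enc_eq_iff [simp]: "enc x = enc y \<longleftrightarrow> x = y"

instantiation nat :: encodable
begin
definition "enc (n::nat) = n"
instance by standard (simp add: enc_nat_def)
end

instantiation bool :: encodable
begin
definition "enc (b::bool) = of_bool b"
instance by standard (auto simp: enc_bool_def)
end

instantiation int :: encodable
begin
definition "enc (i::int) = int_encode i"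
instance by standard (simp add: enc_int_def int_encode_eq)
end

instantiation prod :: (encodable, encodable) encodable
begin
definition "enc p = prod_encode (enc (fst p), enc (snd p))"
instance by standard (auto simp: enc_prod_def prod_eq_iff)
end

instantiation list :: (encodable) encodable
begin
definition "enc xs = list_encode (map enc xs)"
instance
proof
  have "inj (enc :: 'a \<Rightarrow> nat)" by (simp add: inj_def)
  then show "enc xs = enc ys \<longleftrightarrow> xs = ys" for xs ys :: "'a list"
    by (simp add: enc_list_def list_encode_eq inj_map_eq_map)
qed
end

instantiation rat :: encodable
begin
text \<open>A rational has many codes; taking the least makes the encoding injective, so that equal
  rationals have equal codes.\<close>

definition "enc (q::rat) = (LEAST n. nat_to_rat_surj n = q)"
instance
proof
  have "nat_to_rat_surj (enc q) = q" for q :: rat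
    unfolding enc_rat_def by (rule LeastI_ex) (metis surj_nat_to_rat_surj surjD)
  then show "enc p = enc q \<longleftrightarrow> p = q" for p q :: rat by metis
qed
end

lemma nat_to_rat_surj_enc [simp]: "nat_to_rat_surj (enc q) = q"
  unfolding enc_rat_def by (rule LeastI_ex) (metis surj_nat_to_rat_surj surjD)

lemma enc_list_simps [simp]:
  "enc [] = 0"
  "enc (x # xs) = Suc (prod_encode (enc x, enc xs))"
  by (simp_all add: enc_list_def)

text \<open>The tracking function is constrained on codes only, so that types whose encoding is not
  onto, such as \<open>bool\<close> and \<open>rat\<close>, are covered.\<close>

definition computable :: "('a::encodable \<Rightarrow> 'b::encodable) \<Rightarrow> bool" where
  "computable f \<longleftrightarrow> (\<exists>g. computable_fun g \<and> (\<forall>x. g (enc x) = enc (f x)))"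

lemma computableI: "computable_fun g \<Longrightarrow> (\<And>x. g (enc x) = enc (f x)) \<Longrightarrow> computable f"
  unfolding computable_def by blast

lemma computable_nat_iff: "computable f \<longleftrightarrow> computable_fun f"
proof
  assume "computable f"
  then obtain g where "computable_fun g" "\<And>x. g x = f x"
    unfolding computable_def enc_nat_def by blast
  then show "computable_fun f" by (simp add: ext[of g f])
qed (auto simp: computable_def enc_nat_def)

lemma computable_compose:
  assumes "computable f" and "computable g"
  shows "computable (\<lambda>x. f (g x))"
proof -
  obtain f' g' where "computable_fun f'" "\<And>x. f' (enc x) = enc (f x)"
    "computable_fun g'" "\<And>x. g' (enc x) = enc (g x)"
    using assms unfolding computable_def by blast
  then show ?thesis
    by (intro computableI[OF computable_fun_comp[of f' g']]) simp_all
qed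

lemma computable_enc: "computable enc"
  by (rule computableI[OF computable_fun_id]) (simp add: enc_nat_def)

lemma computable_if_enc:
  assumes "computable (\<lambda>x. enc (f x))"
  shows "computable f"
  using assms unfolding computable_def enc_nat_def by blast

lemma computable_id: "computable (\<lambda>x. x)"
  by (rule computableI[OF computable_fun_id]) simp

lemma computable_const: "computable (\<lambda>_. c)"
  by (rule computableI[OF computable_fun_const]) simp

lemma computable_Pair:
  assumes "computable f" and "computable g"
  shows "computable (\<lambda>x. (f x, g x))"
proof -
  obtain f' g' where "computable_fun f'" "\<And>x. f' (enc x) = enc (f x)"
    "computable_fun g'" "\<And>x. g' (enc x) = enc (g x)"
    using assms unfolding computable_def by blast
  then show ?thesis
    by (intro computableI[OF computable_fun_pair[of f' g']]) (simp_all add: enc_prod_def)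
qed

lemma computable_fst: "computable f \<Longrightarrow> computable (\<lambda>x. fst (f x))"
  by (rule computable_compose[of fst]) (rule computableI[OF computable_fun_fst], simp_all add: enc_prod_def)

lemma computable_snd: "computable f \<Longrightarrow> computable (\<lambda>x. snd (f x))"
  by (rule computable_compose[of snd]) (rule computableI[OF computable_fun_snd], simp_all add: enc_prod_def)

lemma computable_compose2:
  assumes "computable (\<lambda>p. F (fst p) (snd p))" and "computable f" and "computable g"
  shows "computable (\<lambda>x. F (f x) (g x))"
  using computable_compose[OF assms(1) computable_Pair[OF assms(2,3)]] by simp

lemma computable_rec_nat:
  assumes "computable g"
    and "computable (\<lambda>p. h (fst p) (fst (snd p)) (snd (snd p)))"
    and "computable m"
  shows "computable (\<lambda>x. rec_nat (g x) (\<lambda>i r. h x i r) (m x))"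
proof -
  obtain g' where g': "computable_fun g'" "\<And>x. g' (enc x) = enc (g x)"
    using assms(1) unfolding computable_def by blast
  obtain h' where h': "computable_fun h'"
    "\<And>p. h' (enc p) = enc (h (fst p) (fst (snd p)) (snd (snd p)))"
    using assms(2) unfolding computable_def by blast
  obtain m' where m': "computable_fun m'" "\<And>x. m' (enc x) = m x"
    using assms(3) unfolding computable_def enc_nat_def by blast
  have h'': "h' (prod_encode (enc x, prod_encode (i, enc r))) = enc (h x i r)" for x i r
    using h'(2)[of "(x, (i, r))"] by (simp add: enc_prod_def enc_nat_def)
  show ?thesis
  proof (rule computableI[OF computable_fun_comp[OF computable_fun_rec[OF g'(1) h'(1)]
          computable_fun_pair[OF m'(1) computable_fun_id]]])
    fix x
    have "rec_nat (g' (enc x)) (\<lambda>i r. h' (prod_encode (enc x, prod_encode (i, r)))) n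
        = enc (rec_nat (g x) (\<lambda>i r. h x i r) n)" for n
      by (induction n) (simp_all add: g'(2) h'')
    then show "rec_nat (g' (snd (prod_decode (prod_encode (m' (enc x), enc x)))))
        (\<lambda>i r. h' (prod_encode (snd (prod_decode (prod_encode (m' (enc x), enc x))), prod_encode (i, r))))
        (fst (prod_decode (prod_encode (m' (enc x), enc x))))
      = enc (rec_nat (g x) (\<lambda>i r. h x i r) (m x))"
      by (simp add: m'(2))
  qed
qed

text \<open>A list is coded by 0 or by the successor of the code of its head and tail. A recursion
  that ignores the previous value and reads only the index of its last round therefore performs the
  case distinction.\<close>

lemma computable_case_list:
  assumes "computable l" and "computable f"
    and "computable (\<lambda>p. h (fst p) (fst (snd p)) (snd (snd p)))"
  shows "computable (\<lambda>x. case l x of [] \<Rightarrow> f x | y # ys \<Rightarrow> h x y ys)"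
proof -
  obtain l' where l': "computable_fun l'" "\<And>x. l' (enc x) = enc (l x)"
    using assms(1) unfolding computable_def by blast
  obtain f' where f': "computable_fun f'" "\<And>x. f' (enc x) = enc (f x)"
    using assms(2) unfolding computable_def by blast
  obtain h' where h': "computable_fun h'"
    "\<And>p. h' (enc p) = enc (h (fst p) (fst (snd p)) (snd (snd p)))"
    using assms(3) unfolding computable_def by blast
  have pair: "computable (\<lambda>p. prod_encode (fst p, fst (snd p)))"
  proof (rule computable_compose2[of "\<lambda>a b. prod_encode (a, b)"])
    show "computable (\<lambda>p. prod_encode (fst p, snd p))"
      by (rule computableI[OF computable_fun_id]) (simp add: enc_prod_def enc_nat_def)
  qed (intro computable_fst computable_snd computable_id)+
  have "computable (\<lambda>n. rec_nat (f' n) (\<lambda>i r. h' (prod_encode (n, i))) (l' n))"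
    by (intro computable_rec_nat computable_compose[OF h'(1)[folded computable_nat_iff]] pair
        l'(1)[folded computable_nat_iff] f'(1)[folded computable_nat_iff])
  then have "computable_fun (\<lambda>n. rec_nat (f' n) (\<lambda>i r. h' (prod_encode (n, i))) (l' n))"
    by (simp add: computable_nat_iff)
  then show ?thesis
  proof (rule computableI)
    fix x
    show "rec_nat (f' (enc x)) (\<lambda>i r. h' (prod_encode (enc x, i))) (l' (enc x))
       = enc (case l x of [] \<Rightarrow> f x | y # ys \<Rightarrow> h x y ys)"
      using h'(2)[of "(x, (hd (l x), tl (l x)))"]
      by (cases "l x") (simp_all add: l' f' enc_prod_def)
  qed
qed

section \<open>Arithmetic, logic and bounded search over natural numbers\<close>

lemma computable_Suc: "computable f \<Longrightarrow> computable (\<lambda>x. Suc (f x))"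
  by (rule computable_compose[of Suc]) (simp_all add: computable_nat_iff computable_fun_Suc)

lemma computable_add:
  "computable f \<Longrightarrow> computable g \<Longrightarrow> computable (\<lambda>x. f x + g x :: nat)"
proof -
  assume fg: "computable f" "computable g"
  have "computable (\<lambda>x. rec_nat (g x) (\<lambda>i r. Suc r) (f x))"
    by (intro computable_rec_nat computable_Suc computable_snd computable_id fg)
  moreover have "rec_nat b (\<lambda>i r. Suc r) a = a + b" for a b :: nat
    by (induction a) auto
  ultimately show ?thesis by simp
qed

lemma computable_mult:
  "computable f \<Longrightarrow> computable g \<Longrightarrow> computable (\<lambda>x. f x * g x :: nat)"
proof -
  assume fg: "computable f" "computable g"
  have "computable (\<lambda>x. rec_nat 0 (\<lambda>i r. g x + r) (f x))"
    by (intro computable_rec_nat computable_add computable_compose[OF fg(2)] computable_fst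
        computable_snd computable_id computable_const fg(1))
  moreover have "rec_nat 0 (\<lambda>i r. b + r) a = a * b" for a b :: nat
    by (induction a) auto
  ultimately show ?thesis by simp
qed

lemma computable_power:
  "computable f \<Longrightarrow> computable g \<Longrightarrow> computable (\<lambda>x. f x ^ g x :: nat)"
proof -
  assume fg: "computable f" "computable g"
  have "computable (\<lambda>x. rec_nat 1 (\<lambda>i r. f x * r) (g x))"
    by (intro computable_rec_nat computable_mult computable_compose[OF fg(1)] computable_fst
        computable_snd computable_id computable_const fg(2))
  moreover have "rec_nat 1 (\<lambda>i r. b * r) a = b ^ a" for a b :: nat
    by (induction a) auto
  ultimately show ?thesis by simp
qed

lemma computable_diff:
  "computable f \<Longrightarrow> computable g \<Longrightarrow> computable (\<lambda>x. f x - g x :: nat)"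
proof -
  assume fg: "computable f" "computable g"
  have pred: "computable (\<lambda>n::nat. n - 1)"
  proof -
    have "computable (\<lambda>n. rec_nat (0::nat) (\<lambda>i r. i) n)"
      by (intro computable_rec_nat computable_fst computable_snd computable_id computable_const)
    moreover have "rec_nat (0::nat) (\<lambda>i r. i) n = n - 1" for n by (cases n) auto
    ultimately show ?thesis by simp
  qed
  have "computable (\<lambda>x. rec_nat (f x) (\<lambda>i r. r - 1) (g x))"
    by (intro computable_rec_nat computable_compose[OF pred] computable_snd computable_id fg)
  moreover have "rec_nat a (\<lambda>i r. r - 1) b = a - b" for a b :: nat
    by (induction b) auto
  ultimately show ?thesis by simp
qed

lemma computable_if:
  fixes f :: "'a::encodable \<Rightarrow> 'b::encodable"
  assumes "computable P" and "computable f" and "computable g"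
  shows "computable (\<lambda>x. if P x then f x else g x)"
proof -
  have "computable (\<lambda>x. rec_nat (g x) (\<lambda>i r. f x) (enc (P x)))"
    by (intro computable_rec_nat computable_compose[OF computable_enc] computable_compose[OF assms(2)]
        computable_fst computable_id assms(1,3))
  moreover have "rec_nat b (\<lambda>i r. a) (enc c) = (if c then a else b)" for a b :: 'b and c
    by (simp add: enc_bool_def)
  ultimately show ?thesis by simp
qed

lemma computable_conj:
  assumes "computable P" and "computable Q"
  shows "computable (\<lambda>x. P x \<and> Q x)"
proof -
  have "(\<lambda>x. P x \<and> Q x) = (\<lambda>x. if P x then Q x else False)" by auto
  then show ?thesis by (simp only:) (intro computable_if computable_const assms)
qed

lemma computable_not:
  assumes "computable P"
  shows "computable (\<lambda>x. \<not> P x)"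
proof -
  have "(\<lambda>x. \<not> P x) = (\<lambda>x. if P x then False else True)" by auto
  then show ?thesis by (simp only:) (intro computable_if computable_const assms)
qed

lemma computable_disj: "computable P \<Longrightarrow> computable Q \<Longrightarrow> computable (\<lambda>x. P x \<or> Q x)"
  using computable_not[OF computable_conj[OF computable_not computable_not], of P Q] by simp

lemma computable_imp: "computable P \<Longrightarrow> computable Q \<Longrightarrow> computable (\<lambda>x. P x \<longrightarrow> Q x)"
  unfolding imp_conv_disj by (intro computable_disj computable_not)

lemma computable_less:
  assumes "computable f" and "computable g"
  shows "computable (\<lambda>x. f x < (g x :: nat))"
proof (rule computable_if_enc)
  have "computable (\<lambda>x. rec_nat (0::nat) (\<lambda>i r. 1) (g x - f x))"
    by (intro computable_rec_nat computable_const computable_diff assms)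
  moreover have "rec_nat (0::nat) (\<lambda>i r. 1) (b - a) = enc (a < b)" for a b :: nat
    by (cases "b - a") (auto simp: enc_bool_def)
  ultimately show "computable (\<lambda>x. enc (f x < g x))" by simp
qed

lemma computable_le:
  "computable f \<Longrightarrow> computable g \<Longrightarrow> computable (\<lambda>x. f x \<le> (g x :: nat))"
  unfolding not_less[symmetric] by (intro computable_not computable_less)

lemma computable_eq:
  assumes "computable f" and "computable g"
  shows "computable (\<lambda>x. f x = g x)"
proof -
  have "computable (\<lambda>x. enc (f x) \<le> enc (g x) \<and> enc (g x) \<le> enc (f x))"
    by (intro computable_conj computable_le computable_compose[OF computable_enc] assms)
  then show ?thesis by (simp add: order_eq_iff[symmetric])
qed

lemma computable_Ex_less:
  assumes "computable m" and "computable (\<lambda>p. P (fst p) (snd p))"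
  shows "computable (\<lambda>x. \<exists>i<(m x :: nat). P x i)"
proof -
  have "computable (\<lambda>x. rec_nat False (\<lambda>i r. r \<or> P x i) (m x))"
    by (intro computable_rec_nat computable_disj computable_compose2[OF assms(2)] computable_fst
        computable_snd computable_id computable_const assms(1))
  moreover have "rec_nat False (\<lambda>i r. r \<or> P x i) n \<longleftrightarrow> (\<exists>i<n. P x i)" for x n
    by (induction n) (auto simp: less_Suc_eq)
  ultimately show ?thesis by simp
qed

lemma computable_All_less:
  assumes "computable m" and "computable (\<lambda>p. P (fst p) (snd p))"
  shows "computable (\<lambda>x. \<forall>i<(m x :: nat). P x i)"
  using computable_not[OF computable_Ex_less[OF assms(1) computable_not[OF assms(2)]]] by simp

lemma computable_Least:
  fixes P :: "nat \<Rightarrow> nat \<Rightarrow> bool"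
  assumes "computable (\<lambda>p. P (fst p) (snd p))" and "\<And>x. \<exists>n. P x n"
  shows "computable (\<lambda>x. LEAST n. P x n)"
proof -
  have "computable (\<lambda>n. enc (P (snd (prod_decode n)) (fst (prod_decode n))))"
    by (intro computable_compose[OF computable_enc] computable_compose2[OF assms(1)])
      (simp_all add: computable_nat_iff computable_fun_fst computable_fun_snd)
  then have "computable_fun (\<lambda>n. of_bool ((\<lambda>s x. P x s) (fst (prod_decode n)) (snd (prod_decode n))))"
    by (simp add: computable_nat_iff enc_bool_def)
  from eval_search[OF this] obtain e where
    "\<And>x. \<exists>s. P x s \<Longrightarrow> rec_eval e [x] (LEAST s. P x s)" by metis
  with assms(2) show ?thesis unfolding computable_nat_iff computable_fun_def by blast
qed

lemma computable_div2:
  assumes "computable f"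
  shows "computable (\<lambda>x. f x div 2 :: nat)"
proof -
  have "computable (\<lambda>k. LEAST m. k < 2 * Suc m)"
    by (intro computable_Least computable_less computable_mult computable_Suc computable_fst
        computable_snd computable_id computable_const) presburger
  moreover have "(LEAST m. k < 2 * Suc m) = k div 2" for k :: nat
    by (rule Least_equality) auto
  ultimately have "computable (\<lambda>k::nat. k div 2)" by simp
  from computable_compose[OF this assms] show ?thesis .
qed

lemma computable_even:
  assumes "computable f"
  shows "computable (\<lambda>x. even (f x :: nat))"
proof -
  have "computable (\<lambda>x. 2 * (f x div 2) = f x)"
    by (intro computable_eq computable_mult computable_div2 computable_const assms)
  moreover have "2 * (n div 2) = n \<longleftrightarrow> even n" for n :: nat by presburger
  ultimately show ?thesis by simp
qed

lemma computable_prod_encode: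
  "computable f \<Longrightarrow> computable g \<Longrightarrow> computable (\<lambda>x. prod_encode (f x, g x))"
proof (rule computable_compose2[of "\<lambda>a b. prod_encode (a, b)"])
  show "computable (\<lambda>p. prod_encode (fst p, snd p))"
    by (rule computableI[OF computable_fun_id]) (simp add: enc_prod_def enc_nat_def)
qed

lemma computable_prod_decode: "computable f \<Longrightarrow> computable (\<lambda>x. prod_decode (f x))"
  by (rule computable_compose[of prod_decode])
    (rule computableI[OF computable_fun_id], simp_all add: enc_prod_def enc_nat_def)

lemma computable_list_decode: "computable f \<Longrightarrow> computable (\<lambda>x. list_decode (f x))"
proof (rule computable_compose[of list_decode])
  have "map enc l = l" for l :: "nat list" by (induction l) (auto simp: enc_nat_def)
  then show "computable list_decode"
    by (intro computableI[OF computable_fun_id]) (simp add: enc_list_def enc_nat_def)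
qed

section \<open>Finite lists\<close>

lemma computable_Cons: "computable f \<Longrightarrow> computable g \<Longrightarrow> computable (\<lambda>x. f x # g x)"
proof (rule computable_compose2[of "\<lambda>a b. a # b"])
  show "computable (\<lambda>p. fst p # snd p)"
    by (rule computableI[OF computable_fun_Suc]) (simp add: enc_prod_def)
qed

text \<open>Lets the code of a list serve as the number of rounds when the list is traversed by
  recursion.\<close>

lemma length_le_enc: "length xs \<le> enc xs"
proof (induction xs)
  case (Cons x xs)
  then show ?case using le_prod_encode_2[of "enc xs" "enc x"] by simp
qed simp

lemma computable_fold:
  assumes "computable l" and "computable z"
    and "computable (\<lambda>p. F (fst p) (fst (snd p)) (snd (snd p)))"
  shows "computable (\<lambda>x. fold (\<lambda>y r. F x y r) (l x) (z x))"
proof -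
  \<comment> \<open>The state is the accumulator with the rest of the list. A state with an empty
    rest is a fixed point, so surplus rounds do no harm.\<close>
  define step where "step x s = (case snd s of [] \<Rightarrow> s | y # ys \<Rightarrow> (F x y (fst s), ys))" for x s
  have F: "computable (\<lambda>x. F (f x) (g x) (h x))" if "computable f" "computable g" "computable h"
    for f :: "'x::encodable \<Rightarrow> 'a" and g h
    using computable_compose[OF assms(3) computable_Pair[OF that(1) computable_Pair[OF that(2,3)]]]
    by simp
  have "computable (\<lambda>p. step (fst p) (snd p))"
    unfolding step_def
    by (intro computable_case_list F computable_Pair computable_fst computable_snd computable_id)
  then have step: "computable (\<lambda>x. step (f x) (g x))" if "computable f" "computable g"
    for f :: "'x::encodable \<Rightarrow> 'a" and g
    using computable_compose2 that by blast
  have "computable (\<lambda>x. fst (rec_nat (z x, l x) (\<lambda>i r. step x r) (enc (l x))))"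
    by (intro computable_fst computable_rec_nat computable_Pair step computable_snd computable_id
        computable_compose[OF computable_enc] assms(1,2))
  moreover have iter: "fst (rec_nat (a, ys) (\<lambda>i r. step x r) n) = fold (\<lambda>y r. F x y r) ys a"
    if "length ys \<le> n" for x a ys n
  proof -
    have "rec_nat (step x s) (\<lambda>i r. step x r) n = step x (rec_nat s (\<lambda>i r. step x r) n)" for s n
      by (induction n) auto
    then have "rec_nat s (\<lambda>i r. step x r) (Suc n) = rec_nat (step x s) (\<lambda>i r. step x r) n" for s n
      by simp
    moreover have "rec_nat (a, []) (\<lambda>i r. step x r) n = (a, [])" for a n
      by (induction n) (auto simp: step_def)
    ultimately show ?thesis using that
    proof (induction n arbitrary: a ys)
      case (Suc n)
      then show ?case
        by (cases ys) (simp_all add: step_def del: nat.rec(2))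
    qed simp
  qed
  ultimately show ?thesis by (simp add: length_le_enc)
qed

lemma computable_length:
  assumes "computable l"
  shows "computable (\<lambda>x. length (l x))"
proof -
  have "computable (\<lambda>x. fold (\<lambda>y r. Suc r) (l x) 0)"
    by (intro computable_fold assms computable_Suc computable_const computable_snd computable_id)
  moreover have "fold (\<lambda>y r. Suc r) ys n = length ys + n" for ys :: "'b list" and n
    by (induction ys arbitrary: n) auto
  ultimately show ?thesis by simp
qed

lemma computable_foldr:
  assumes "computable l" and "computable z"
    and "computable (\<lambda>p. F (fst p) (fst (snd p)) (snd (snd p)))"
  shows "computable (\<lambda>x. foldr (\<lambda>y r. F x y r) (l x) (z x))"
proof -
  have "computable (\<lambda>x. fold (\<lambda>y r. y # r) (l x) [])"
    by (intro computable_fold assms computable_Cons computable_const computable_fst computable_snd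
        computable_id)
  then have "computable (\<lambda>x. rev (l x))" by (simp add: fold_Cons_rev)
  from computable_fold[OF this assms(2,3)] show ?thesis by (simp add: foldr_conv_fold)
qed

lemma computable_filter:
  assumes "computable l" and "computable (\<lambda>p. P (fst p) (snd p))"
  shows "computable (\<lambda>x. filter (\<lambda>y. P x y) (l x))"
proof -
  have "computable (\<lambda>x. foldr (\<lambda>y r. if P x y then y # r else r) (l x) [])"
    by (intro computable_foldr assms(1) computable_if computable_compose2[OF assms(2)]
        computable_Cons computable_const computable_fst computable_snd computable_id)
  moreover have "foldr (\<lambda>y r. if Q y then y # r else r) ys [] = filter Q ys" for Q and ys :: "'b list"
    by (induction ys) auto
  ultimately show ?thesis by simp
qed

lemma computable_Ex_list:
  assumes "computable l" and "computable (\<lambda>p. P (fst p) (snd p))"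
  shows "computable (\<lambda>x. \<exists>y\<in>set (l x). P x y)"
proof -
  have "computable (\<lambda>x. fold (\<lambda>y r. r \<or> P x y) (l x) False)"
    by (intro computable_fold assms(1) computable_disj computable_compose2[OF assms(2)]
        computable_const computable_fst computable_snd computable_id)
  moreover have "fold (\<lambda>y r. r \<or> Q y) ys b \<longleftrightarrow> b \<or> (\<exists>y\<in>set ys. Q y)" for Q and ys :: "'b list" and b
    by (induction ys arbitrary: b) auto
  ultimately show ?thesis by simp
qed

lemma computable_member:
  assumes "computable f" and "computable l"
  shows "computable (\<lambda>x. f x \<in> set (l x))"
proof -
  have "computable (\<lambda>x. \<exists>y\<in>set (l x). y = f x)"
    by (intro computable_Ex_list assms computable_eq computable_compose[OF assms(1)]
        computable_fst computable_snd computable_id)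
  then show ?thesis by simp
qed

text \<open>\<open>hd (drop i l)\<close> replaces indexing: past the end of the list it has the
  constant value \<open>hd []\<close>, so it is computable without a bound on the index.\<close>

lemma computable_nth_drop:
  assumes "computable l" and "computable i"
  shows "computable (\<lambda>x. hd (drop (i x) (l x)))"
proof -
  have tl: "computable (\<lambda>x. tl (f x))" if "computable f" for f :: "'x::encodable \<Rightarrow> 'b list"
  proof -
    have "computable (\<lambda>x. case f x of [] \<Rightarrow> [] | y # ys \<Rightarrow> ys)"
      by (intro computable_case_list that computable_const computable_snd computable_id)
    moreover have "(case ys of [] \<Rightarrow> [] | y # ys \<Rightarrow> ys) = tl ys" for ys :: "'b list"
      by (cases ys) auto
    ultimately show ?thesis by simp
  qed
  have hd: "computable (\<lambda>x. hd (f x))" if "computable f" for f :: "'x::encodable \<Rightarrow> 'b list"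
  proof -
    have "computable (\<lambda>x. case f x of [] \<Rightarrow> hd [] | y # ys \<Rightarrow> y)"
      by (intro computable_case_list that computable_const computable_fst computable_snd computable_id)
    moreover have "(case ys of [] \<Rightarrow> hd [] | y # ys \<Rightarrow> y) = hd ys" for ys :: "'b list"
      by (cases ys) auto
    ultimately show ?thesis by simp
  qed
  have "computable (\<lambda>x. rec_nat (l x) (\<lambda>_ r. tl r) (i x))"
    by (intro computable_rec_nat tl computable_snd computable_id assms)
  moreover have "rec_nat ys (\<lambda>_ r. tl r) n = drop n ys" for ys :: "'b list" and n
    by (induction n) (auto simp: drop_Suc tl_drop)
  ultimately have "computable (\<lambda>x. drop (i x) (l x))" by simp
  then show ?thesis by (rule hd)
qed

lemmas computable_intros =
  computable_id computable_const computable_Pair computable_fst computable_snd computable_Suc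
  computable_add computable_mult computable_power computable_diff computable_if computable_conj
  computable_disj computable_not computable_imp computable_less computable_le computable_eq
  computable_Ex_less computable_All_less computable_div2 computable_even computable_prod_encode
  computable_prod_decode computable_list_decode computable_Cons computable_length
  computable_filter computable_Ex_list computable_member computable_nth_drop

section \<open>Integer and rational arithmetic\<close>

lemma computable_int_diff:
  assumes "computable f" and "computable g"
  shows "computable (\<lambda>x. int (f x) - int (g x))"
proof (rule computable_if_enc)
  have "enc (int a - int b) = (if b \<le> a then 2 * (a - b) else Suc (2 * (b - a - 1)))" for a b
    by (auto simp: enc_int_def int_encode_def sum_encode_def nat_diff_distrib' of_nat_diff)
  then show "computable (\<lambda>x. enc (int (f x) - int (g x)))"
    by (simp only:) (intro computable_intros assms)
qed

text \<open>Nonnegative integers have even codes and negative ones odd codes. The positive and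
  negative parts obtained here reduce integer arithmetic to that of natural numbers.\<close>

lemma computable_nat_of_int:
  assumes "computable f"
  shows "computable (\<lambda>x. nat (f x))" and "computable (\<lambda>x. nat (- f x))"
proof -
  have "nat i = (if even (enc i) then enc i div 2 else 0)"
    and "nat (- i) = (if even (enc i) then 0 else Suc (enc i div 2))" for i
    by (auto simp: enc_int_def int_encode_def sum_encode_def)
  then show "computable (\<lambda>x. nat (f x))" "computable (\<lambda>x. nat (- f x))"
    by (simp_all only:) (intro computable_intros computable_compose[OF computable_enc] assms)+
qed

lemma computable_int_minus:
  assumes "computable f" and "computable g"
  shows "computable (\<lambda>x. f x - g x :: int)"
proof -
  have "(\<lambda>x. f x - g x) = (\<lambda>x. int (nat (f x) + nat (- g x)) - int (nat (- f x) + nat (g x)))"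
    by (rule ext) linarith
  then show ?thesis
    by (simp only:) (intro computable_int_diff computable_add computable_nat_of_int assms)
qed

lemma computable_int_mult:
  assumes "computable f" and "computable g"
  shows "computable (\<lambda>x. f x * g x :: int)"
proof -
  have "i * j = int (nat i * nat j + nat (- i) * nat (- j)) - int (nat i * nat (- j) + nat (- i) * nat j)"
    for i j :: int
    by (cases "0 \<le> i"; cases "0 \<le> j") (simp_all add: zero_le_mult_iff)
  then show ?thesis
    by (simp only:)
      (intro computable_int_diff computable_add computable_mult computable_nat_of_int assms)
qed

lemma computable_int_pos:
  assumes "computable f"
  shows "computable (\<lambda>x. 0 < (f x :: int))"
proof -
  have "0 < i \<longleftrightarrow> 0 < nat i" for i by simp
  then show ?thesis
    by (simp only:) (intro computable_intros computable_nat_of_int assms)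
qed

lemma computable_int_decode: "computable f \<Longrightarrow> computable (\<lambda>x. int_decode (f x))"
  by (rule computable_compose[of int_decode])
    (rule computableI[OF computable_fun_id], simp_all add: enc_int_def enc_nat_def)

definition code_num :: "nat \<Rightarrow> int" where
  "code_num n = int_decode (fst (prod_decode n))"

text \<open>Junk values: a code with denominator 0 stands for the rational 0.\<close>

definition code_den :: "nat \<Rightarrow> int" where
  "code_den n = int_decode (snd (prod_decode n))"

lemma nat_to_rat_surj_eq: "nat_to_rat_surj n = Fract (code_num n) (code_den n)"
  by (simp add: nat_to_rat_surj_def code_num_def code_den_def case_prod_beta)

lemma computable_code_num: "computable f \<Longrightarrow> computable (\<lambda>x. code_num (f x))"
  unfolding code_num_def by (intro computable_int_decode computable_intros)

lemma computable_code_den: "computable f \<Longrightarrow> computable (\<lambda>x. code_den (f x))"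
  unfolding code_den_def by (intro computable_int_decode computable_intros)

text \<open>Makes equality of coded rationals decidable by cross multiplication. Zero is treated
  apart because a zero denominator also codes the rational 0.\<close>

lemma nat_to_rat_surj_eq_iff:
  "nat_to_rat_surj m = nat_to_rat_surj n \<longleftrightarrow>
    (if code_den m = 0 \<or> code_num m = 0 then code_den n = 0 \<or> code_num n = 0
     else code_den n \<noteq> 0 \<and> code_num m * code_den n = code_num n * code_den m)"
  by (cases "code_den n = 0")
    (auto simp: nat_to_rat_surj_eq Fract_of_int_quotient frac_eq_eq of_int_mult[symmetric]
      simp del: of_int_mult)

text \<open>The least code of the same rational is found by search, using decidable equality; the
  search ends because the given code itself qualifies.\<close>

lemma computable_nat_to_rat_surj:
  assumes "computable f"
  shows "computable (\<lambda>x. nat_to_rat_surj (f x))"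
proof (rule computable_compose[OF _ assms], rule computable_if_enc)
  have "computable (\<lambda>p. nat_to_rat_surj (snd p) = nat_to_rat_surj (fst p))"
    unfolding nat_to_rat_surj_eq_iff
    by (intro computable_intros computable_int_mult computable_code_num computable_code_den)
  then have "computable (\<lambda>n. LEAST m. nat_to_rat_surj m = nat_to_rat_surj n)"
    by (rule computable_Least) blast
  then show "computable (\<lambda>n. enc (nat_to_rat_surj n))"
    by (simp add: enc_rat_def)
qed

lemma computable_Fract:
  assumes "computable f" and "computable g"
  shows "computable (\<lambda>x. Fract (f x) (g x))"
proof -
  have "Fract a b = nat_to_rat_surj (prod_encode (enc a, enc b))" for a b
    by (simp add: nat_to_rat_surj_def enc_int_def)
  then show ?thesis
    by (simp only:)
      (intro computable_nat_to_rat_surj computable_prod_encode computable_compose[OF computable_enc]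
        assms)
qed

text \<open>A fraction for \<open>q\<close> read off its least code and repaired to 0/1 if the
  denominator is 0. The denominator may still be negative, which is why signs are tested on the
  product of the two parts.\<close>

definition num_of :: "rat \<Rightarrow> int" where
  "num_of q = (if code_den (enc q) = 0 then 0 else code_num (enc q))"

definition den_of :: "rat \<Rightarrow> int" where
  "den_of q = (if code_den (enc q) = 0 then 1 else code_den (enc q))"

lemma den_of_nonzero: "den_of q \<noteq> 0"
  by (simp add: den_of_def)

lemma Fract_num_of_den_of: "Fract (num_of q) (den_of q) = q"
  using nat_to_rat_surj_eq[of "enc q"]
  by (auto simp: num_of_def den_of_def Fract_of_int_quotient)

lemma computable_num_of: "computable f \<Longrightarrow> computable (\<lambda>x. num_of (f x))"
  unfolding num_of_def
  by (intro computable_intros computable_code_num computable_code_den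
      computable_compose[OF computable_enc])

lemma computable_den_of: "computable f \<Longrightarrow> computable (\<lambda>x. den_of (f x))"
  unfolding den_of_def
  by (intro computable_intros computable_code_den computable_compose[OF computable_enc])

lemma computable_rat_minus:
  assumes "computable f" and "computable g"
  shows "computable (\<lambda>x. f x - g x :: rat)"
proof -
  have "p - q = Fract (num_of p * den_of q - num_of q * den_of p) (den_of p * den_of q)" for p q
    using diff_rat[OF den_of_nonzero[of p] den_of_nonzero[of q], of "num_of p" "num_of q"]
    by (simp add: Fract_num_of_den_of)
  then show ?thesis
    by (simp only:) (intro computable_Fract computable_int_minus computable_int_mult
        computable_num_of computable_den_of assms)
qed

lemma computable_rat_uminus: "computable f \<Longrightarrow> computable (\<lambda>x. - f x :: rat)"
  using computable_rat_minus[OF computable_const[of 0], of f] by simp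

lemma computable_rat_add:
  "computable f \<Longrightarrow> computable g \<Longrightarrow> computable (\<lambda>x. f x + g x :: rat)"
  using computable_rat_minus[OF _ computable_rat_uminus, of f g] by simp

lemma computable_rat_less:
  assumes "computable f" and "computable g"
  shows "computable (\<lambda>x. f x < (g x :: rat))"
proof -
  have "0 < Fract a b \<longleftrightarrow> 0 < a * b" if "b \<noteq> 0" for a b
    using that by (simp add: Fract_of_int_quotient zero_less_divide_iff zero_less_mult_iff)
  then have "p < q \<longleftrightarrow> 0 < num_of (q - p) * den_of (q - p)" for p q
    by (metis Fract_num_of_den_of den_of_nonzero diff_gt_0_iff_gt)
  then show ?thesis
    by (simp only:) (intro computable_int_pos computable_int_mult computable_num_of
        computable_den_of computable_rat_minus assms)
qed

lemma computable_rat_le: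
  "computable f \<Longrightarrow> computable g \<Longrightarrow> computable (\<lambda>x. f x \<le> (g x :: rat))"
  unfolding not_less[symmetric] by (intro computable_not computable_rat_less)

lemma computable_inverse_power2:
  assumes "computable f"
  shows "computable (\<lambda>x. 1 / 2 ^ f x :: rat)"
proof -
  have "(1 / 2 ^ n :: rat) = Fract 1 (int (2 ^ n) - int 0)" for n
    by (simp add: Fract_of_int_quotient)
  then show ?thesis
    by (simp only:) (intro computable_Fract computable_int_diff computable_intros assms)
qed

lemmas computable_rat_intros = computable_intros computable_rat_minus computable_rat_uminus
  computable_rat_add computable_rat_less computable_rat_le computable_inverse_power2
  computable_nat_to_rat_surj

section \<open>Computably enumerable sets\<close>

lemma ce_set_Ex:
  assumes "computable (\<lambda>p. P (fst p) (snd p))"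
  shows "ce_set {x. \<exists>s::nat. P x s}"
proof -
  have "computable (\<lambda>n. enc (P (snd (prod_decode n)) (fst (prod_decode n))))"
    by (intro computable_compose[OF computable_enc] computable_compose2[OF assms(1)]
        computable_intros)
  then have "computable_fun (\<lambda>n. of_bool ((\<lambda>s x. P x s) (fst (prod_decode n)) (snd (prod_decode n))))"
    by (simp add: computable_nat_iff enc_bool_def)
  from eval_search[OF this] obtain e where
    e: "\<And>x. (\<exists>y. rec_eval e [x] y) \<longleftrightarrow> (\<exists>s. P x s)" by metis
  show ?thesis unfolding ce_set_def by (rule exI[of _ e]) (simp add: e)
qed

section \<open>Coding of programs and decidable evaluation\<close>

primrec prog_code :: "recf \<Rightarrow> nat" where
  "prog_code Zero = prod_encode (0, 0)"
| "prog_code Succ = prod_encode (1, 0)"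
| "prog_code (Proj i) = prod_encode (2, i)"
| "prog_code (Comp f gs) = prod_encode (3, prod_encode (prog_code f, list_encode (map prog_code gs)))"
| "prog_code (PrimRec f g) = prod_encode (4, prod_encode (prog_code f, prog_code g))"
| "prog_code (Mu f) = prod_encode (5, prog_code f)"

text \<open>
  Evaluation is made decidable by certificates: a certificate is a list of triples (program code,
  arguments, value), newest first, each following from the triples behind it by one evaluation rule.
\<close>

type_synonym fact = "nat \<times> nat list \<times> nat"

text \<open>Stated for arbitrary numbers as program codes, with one disjunct per tag of
  \<open>prog_code\<close>, so that it can be decided without decoding programs.\<close>

definition justified :: "fact \<Rightarrow> fact list \<Rightarrow> bool" where
  "justified w L \<longleftrightarrow> (let e = fst w; xs = fst (snd w); y = snd (snd w);
      t = fst (prod_decode e); p = snd (prod_decode e);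
      f = fst (prod_decode p); g = snd (prod_decode p) in
    t = 0 \<and> y = 0 \<or>
    t = 1 \<and> 0 < y \<and> xs = [y - 1] \<or>
    t = 2 \<and> p < length xs \<and> hd (drop p xs) = y \<or>
    t = 3 \<and> (\<exists>v\<in>set L. fst v = f \<and> snd (snd v) = y \<and>
      length (fst (snd v)) = length (list_decode g) \<and>
      (\<forall>i<length (list_decode g).
        (hd (drop i (list_decode g)), xs, hd (drop i (fst (snd v)))) \<in> set L)) \<or>
    t = 4 \<and> (case xs of [] \<Rightarrow> False | n # zs \<Rightarrow>
      if n = 0 then (f, zs, y) \<in> set L
      else \<exists>v\<in>set L. fst v = e \<and> fst (snd v) = (n - 1) # zs \<and>
        (g, (n - 1) # snd (snd v) # zs, y) \<in> set L) \<or>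
    t = 5 \<and> (p, y # xs, 0) \<in> set L \<and>
      (\<forall>m<y. \<exists>v\<in>set L. fst v = p \<and> fst (snd v) = m # xs \<and> 0 < snd (snd v)))"

primrec certificate :: "fact list \<Rightarrow> bool" where
  "certificate [] \<longleftrightarrow> True"
| "certificate (w # L) \<longleftrightarrow> certificate L \<and> justified w L"

text \<open>The tag of the code admits only the disjunct of the outermost constructor of
  \<open>f\<close>, and the facts it relies on lie further back in the list, where the induction
  hypothesis applies.\<close>

lemma certificate_sound:
  "certificate L \<Longrightarrow> (prog_code f, xs, y) \<in> set L \<Longrightarrow> rec_eval f xs y"
proof (induction L arbitrary: f xs y)
  case (Cons w L)
  have IH: "rec_eval f xs y" if "(prog_code f, xs, y) \<in> set L" for f xs y
    using Cons that by simp
  show ?case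
  proof (cases "(prog_code f, xs, y) \<in> set L")
    case False
    with Cons.prems have w: "justified (prog_code f, xs, y) L" by auto
    show ?thesis
    proof (cases f)
      case Zero
      with w show ?thesis by (simp add: justified_def Let_def eval_Zero)
    next
      case Succ
      with w have "xs = [y - 1]" "0 < y" by (simp_all add: justified_def Let_def)
      with Succ eval_Succ[of "y - 1"] show ?thesis by simp
    next
      case (Proj i)
      with w have "i < length xs" "xs ! i = y"
        by (auto simp: justified_def Let_def hd_drop_conv_nth)
      with Proj show ?thesis using eval_Proj by blast
    next
      case (Comp h gs)
      with w obtain ys where ys: "(prog_code h, ys, y) \<in> set L" "length ys = length gs"
        and gs: "\<And>i. i < length gs \<Longrightarrow> (prog_code (gs ! i), xs, ys ! i) \<in> set L"
        by (auto simp: justified_def Let_def hd_drop_conv_nth)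
      show ?thesis unfolding Comp
        by (rule eval_Comp[OF _ IH[OF ys(1)]])
          (use ys(2) gs IH in \<open>auto simp: list_all2_conv_all_nth\<close>)
    next
      case (PrimRec h g)
      with w obtain n zs where xs: "xs = n # zs"
        by (auto simp: justified_def Let_def split: list.splits)
      show ?thesis
      proof (cases n)
        case 0
        with w PrimRec xs have "(prog_code h, zs, y) \<in> set L"
          by (simp add: justified_def Let_def)
        with PrimRec xs 0 IH show ?thesis by (auto intro: eval_PrimRec_0)
      next
        case (Suc m)
        with w PrimRec xs obtain z where "(prog_code (PrimRec h g), m # zs, z) \<in> set L"
          "(prog_code g, m # z # zs, y) \<in> set L"
          by (auto simp: justified_def Let_def)
        with IH have "rec_eval (PrimRec h g) (m # zs) z" "rec_eval g (m # z # zs) y" by blast+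
        with PrimRec xs Suc show ?thesis by (auto intro: eval_PrimRec_Suc)
      qed
    next
      case (Mu h)
      with w have 0: "(prog_code h, y # xs, 0) \<in> set L"
        and m: "\<forall>m<y. \<exists>v\<in>set L. fst v = prog_code h \<and> fst (snd v) = m # xs \<and> 0 < snd (snd v)"
        by (auto simp: justified_def Let_def)
      have "\<exists>z. rec_eval h (m # xs) (Suc z)" if "m < y" for m
      proof -
        from m that obtain v where "v \<in> set L" "fst v = prog_code h" "fst (snd v) = m # xs"
          "0 < snd (snd v)" by blast
        moreover from this obtain z where "snd (snd v) = Suc z" using gr0_implies_Suc by blast
        ultimately have "(prog_code h, m # xs, Suc z) \<in> set L" by (metis prod.collapse)
        with IH show ?thesis by blast
      qed
      with Mu IH[OF 0] show ?thesis by (auto intro: eval_Mu)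
    qed
  qed (rule IH)
qed simp

text \<open>The list enters only through positive occurrences of membership, so more facts never
  destroy a justification. This is what makes certificates closed under concatenation.\<close>

lemma justified_mono: "justified w L \<Longrightarrow> set L \<subseteq> set M \<Longrightarrow> justified w M"
  unfolding justified_def Let_def
  by (elim disj_forward conj_forward; (blast | (auto split: list.splits if_splits; blast)))

lemma certificate_append: "certificate L \<Longrightarrow> certificate M \<Longrightarrow> certificate (L @ M)"
  by (induction L) (auto intro: justified_mono)

text \<open>For the rules of \<open>Comp\<close> and \<open>Mu\<close>, whose number of premises is
  not fixed.\<close>

lemma certificate_finite:
  assumes "finite F" and "\<And>w. w \<in> F \<Longrightarrow> \<exists>L. certificate L \<and> w \<in> set L"
  shows "\<exists>L. certificate L \<and> F \<subseteq> set L"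
  using assms
proof (induction F rule: finite_induct)
  case empty
  show ?case by (intro exI[of _ "[]"]) simp
next
  case (insert w F)
  then obtain L M where "certificate L" "F \<subseteq> set L" "certificate M" "w \<in> set M" by blast
  then show ?case using certificate_append by (intro exI[of _ "L @ M"]) auto
qed

lemma certificate_complete:
  "rec_eval f xs y \<Longrightarrow> \<exists>L. certificate L \<and> (prog_code f, xs, y) \<in> set L"
proof (induction rule: rec_eval.induct)
  case (eval_Zero xs)
  show ?case
    by (rule exI[of _ "[(prog_code Zero, xs, 0)]"]) (simp add: justified_def Let_def)
next
  case (eval_Succ x)
  show ?case
    by (rule exI[of _ "[(prog_code Succ, [x], Suc x)]"]) (simp add: justified_def Let_def)
next
  case (eval_Proj i xs)
  then show ?case
    by (intro exI[of _ "[(prog_code (Proj i), xs, xs ! i)]"])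
      (simp add: justified_def Let_def hd_drop_conv_nth)
next
  case (eval_Comp xs gs ys f z)
  have len: "length gs = length ys"
    using eval_Comp.IH(1) by (rule list_all2_lengthD)
  let ?F = "insert (prog_code f, ys, z) ((\<lambda>i. (prog_code (gs ! i), xs, ys ! i)) ` {..<length gs})"
  have "\<exists>L. certificate L \<and> ?F \<subseteq> set L"
    by (rule certificate_finite) (use eval_Comp.IH in \<open>auto simp: list_all2_conv_all_nth\<close>)
  then obtain L where "certificate L" "?F \<subseteq> set L" by blast
  with len show ?case
    by (intro exI[of _ "(prog_code (Comp f gs), xs, z) # L"])
      (auto simp: justified_def Let_def hd_drop_conv_nth intro!: bexI[of _ "(prog_code f, ys, z)"])
next
  case (eval_PrimRec_0 f xs z g)
  then obtain L where "certificate L" "(prog_code f, xs, z) \<in> set L" by blast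
  then show ?case
    by (intro exI[of _ "(prog_code (PrimRec f g), 0 # xs, z) # L"]) (simp add: justified_def Let_def)
next
  case (eval_PrimRec_Suc f g n xs y z)
  then obtain L M where "certificate L" "(prog_code (PrimRec f g), n # xs, y) \<in> set L"
    "certificate M" "(prog_code g, n # y # xs, z) \<in> set M" by blast
  then show ?case
    using certificate_append
    by (intro exI[of _ "(prog_code (PrimRec f g), Suc n # xs, z) # L @ M"])
      (auto simp: justified_def Let_def intro!: bexI[of _ "(prog_code (PrimRec f g), n # xs, y)"])
next
  case (eval_Mu f n xs)
  from eval_Mu.IH(2) obtain y where
    y: "\<And>m. m < n \<Longrightarrow> \<exists>L. certificate L \<and> (prog_code f, m # xs, Suc (y m)) \<in> set L" by metis
  let ?F = "insert (prog_code f, n # xs, 0) ((\<lambda>m. (prog_code f, m # xs, Suc (y m))) ` {..<n})"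
  have "\<exists>L. certificate L \<and> ?F \<subseteq> set L"
    by (rule certificate_finite) (use eval_Mu.IH(1) y in auto)
  then obtain L where L: "certificate L" "?F \<subseteq> set L" by blast
  have "\<exists>v\<in>set L. fst v = prog_code f \<and> fst (snd v) = m # xs \<and> 0 < snd (snd v)" if "m < n" for m
    by (rule bexI[of _ "(prog_code f, m # xs, Suc (y m))"]) (use L that in auto)
  with L show ?case
    by (intro exI[of _ "(prog_code (Mu f), xs, n) # L"]) (simp add: justified_def Let_def)
qed

lemma computable_certificate: "computable certificate"
proof -
  have just: "computable (\<lambda>p. justified (fst p) (snd p))"
    unfolding justified_def Let_def
    by (intro computable_intros computable_case_list)
  \<comment> \<open>The fold rebuilds the tail in its first component, because each entry must be
    checked against the entries behind it.\<close>
  have "computable (\<lambda>L. snd (foldr (\<lambda>w r. (w # fst r, snd r \<and> justified w (fst r))) L ([], True)))"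
    by (intro computable_snd computable_foldr computable_intros
        computable_compose2[OF just])
  moreover have "foldr (\<lambda>w r. (w # fst r, snd r \<and> justified w (fst r))) L ([], True) = (L, certificate L)"
    for L by (induction L) auto
  moreover have "(\<lambda>L. certificate L) = certificate" by simp
  ultimately show ?thesis by simp
qed

text \<open>Inverse of \<open>enc\<close> on lists of facts. Every number decodes to such a list, so
  searching for a certificate is searching through the natural numbers.\<close>

definition decode_certificate :: "nat \<Rightarrow> fact list" where
  "decode_certificate c = map (\<lambda>w. (fst (prod_decode w),
    list_decode (fst (prod_decode (snd (prod_decode w)))), snd (prod_decode (snd (prod_decode w)))))
    (list_decode c)"

lemma enc_nat_list: "enc (xs :: nat list) = list_encode xs"
  by (induction xs) (simp_all add: enc_nat_def)

lemma enc_decode_certificate: "enc (decode_certificate c) = c"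
  by (simp add: decode_certificate_def enc_list_def enc_prod_def comp_def enc_nat_def
      enc_nat_list[unfolded enc_list_def] enc_list_def[symmetric] enc_nat_list)

lemma computable_decode_certificate: "computable decode_certificate"
  by (rule computableI[OF computable_fun_id]) (simp add: enc_decode_certificate enc_nat_def)

text \<open>The last argument is a certificate, not a step count, so the relation need not be
  monotone in it; \<open>listed\<close> regains monotonicity by searching below a bound.\<close>

definition halts :: "nat \<Rightarrow> nat \<Rightarrow> nat \<Rightarrow> bool" where
  "halts e x c \<longleftrightarrow> certificate (decode_certificate c) \<and>
    (\<exists>v\<in>set (decode_certificate c). fst v = e \<and> fst (snd v) = [x])"

lemma computable_halts:
  "computable f \<Longrightarrow> computable g \<Longrightarrow> computable h \<Longrightarrow> computable (\<lambda>x. halts (f x) (g x) (h x))"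
proof -
  assume fgh: "computable f" "computable g" "computable h"
  have "computable (\<lambda>p. halts (fst p) (fst (snd p)) (snd (snd p)))"
    unfolding halts_def
    by (intro computable_intros computable_compose[OF computable_certificate]
        computable_compose[OF computable_decode_certificate])
  from computable_compose[OF this computable_Pair[OF fgh(1) computable_Pair[OF fgh(2,3)]]]
  show ?thesis by simp
qed

lemma halts_iff: "(\<exists>c. halts (prog_code f) x c) \<longleftrightarrow> (\<exists>y. rec_eval f [x] y)"
proof
  assume "\<exists>c. halts (prog_code f) x c"
  then show "\<exists>y. rec_eval f [x] y"
    unfolding halts_def by (metis certificate_sound prod.collapse)
next
  assume "\<exists>y. rec_eval f [x] y"
  then obtain y L where L: "certificate L" "(prog_code f, [x], y) \<in> set L"
    using certificate_complete by blast
  have "decode_certificate (enc L) = L"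
    using enc_decode_certificate[of "enc L"] by simp
  with L have "halts (prog_code f) x (enc L)" unfolding halts_def by force
  then show "\<exists>c. halts (prog_code f) x c" ..
qed

text \<open>Ensures that the requirements, which range over all numbers \<open>e\<close>, meet every
  computably enumerable set.\<close>

lemma ce_set_halts:
  assumes "ce_set A"
  obtains e where "\<And>x. x \<in> A \<longleftrightarrow> (\<exists>c. halts e x c)"
proof -
  obtain f where "A = {n. \<exists>y. rec_eval f [n] y}"
    using assms unfolding ce_set_def by blast
  with that[of "prog_code f"] show ?thesis by (simp add: halts_iff)
qed

section \<open>The construction\<close>

text \<open>Negation turns right cuts into left cuts, so the two kinds of requirements can be
  treated together, with the parity of the index selecting the sign.\<close>

definition signed :: "nat \<Rightarrow> 'a::ab_group_add \<Rightarrow> 'a" where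
  "signed k x = (if even k then x else - x)"

lemma of_rat_signed: "of_rat (signed k x) = (signed k (of_rat x) :: real)"
  by (simp add: signed_def of_rat_minus)

lemma computable_signed:
  "computable f \<Longrightarrow> computable g \<Longrightarrow> computable (\<lambda>x. signed (f x) (g x :: rat))"
  unfolding signed_def by (intro computable_rat_intros)

text \<open>Through the pairing, every requirement gets its turn at arbitrarily late stages.\<close>

definition idx :: "nat \<Rightarrow> nat" where
  "idx s = fst (prod_decode s)"

lemma idx_prod_encode [simp]: "idx (prod_encode (k, j)) = k"
  by (simp add: idx_def)

lemma idx_le: "idx s \<le> s"
  using le_prod_encode_1[of "fst (prod_decode s)" "snd (prod_decode s)"] by (simp add: idx_def)

definition listed :: "nat \<Rightarrow> nat \<Rightarrow> nat \<Rightarrow> bool" where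
  "listed e i s \<longleftrightarrow> i < s \<and> (\<exists>c<s. halts e i c)"

lemma listed_mono: "listed e i s \<Longrightarrow> s \<le> t \<Longrightarrow> listed e i t"
  unfolding listed_def by (meson less_le_trans)

text \<open>Taken at \<open>k\<close>, it counts the actions of higher priority than
  \<open>k\<close> and sets the level of the test; taken at \<open>Suc k\<close>, it includes the
  actions of \<open>k\<close> itself and sets the precision.\<close>

definition cnt :: "(nat \<times> rat) list \<Rightarrow> nat \<Rightarrow> nat" where
  "cnt L k = length (filter (\<lambda>p. fst p < k) L)"

lemma cnt_mono: "j \<le> k \<Longrightarrow> cnt L j \<le> cnt L k"
  unfolding cnt_def by (induction L) auto

lemma sum_inverse_power2_le:
  "(\<Sum>n\<in>{i..<j}. 1 / 2 ^ n) \<le> (2 / 2 ^ i :: real)"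
proof (cases "i \<le> j")
  case True
  then have "(\<Sum>n\<in>{i..<j}. 1 / 2 ^ n) = (2 / 2 ^ i - 2 / 2 ^ j :: real)"
    by (induction rule: dec_induct) simp_all
  then show ?thesis by simp
qed simp

text \<open>
  \<open>cov n p q s\<close> means that by stage \<open>s\<close> one of the intervals of \<open>U n\<close> has been found to contain
  \<open>p\<close> and \<open>q\<close>. The state consists of the approximation of \<open>\<beta>\<close> and of the history of the actions,
  newest first; an action is recorded as the index of the requirement and the approximation of
  \<open>\<alpha>\<close> at that stage. Stage \<open>s\<close> deals with the requirement \<open>idx s\<close>.
\<close>

locale construction =
  fixes \<alpha> :: real and a :: "nat \<Rightarrow> rat"
    and U :: "nat \<Rightarrow> real set" and cov :: "nat \<Rightarrow> rat \<Rightarrow> rat \<Rightarrow> nat \<Rightarrow> bool"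
  assumes a_mono: "s \<le> t \<Longrightarrow> a s \<le> a t"
    and a_less: "of_rat (a s) < \<alpha>"
    and a_lim: "(\<lambda>s. of_rat (a s)) \<longlonglongrightarrow> \<alpha>"
    and computable_a: "computable a"
    and cov_sound: "cov n p q s \<Longrightarrow> {of_rat p..of_rat q} \<subseteq> U n"
    and cov_complete: "\<exists>x<\<alpha>. \<exists>s0. \<forall>s\<ge>s0. \<forall>p q. x < of_rat p \<longrightarrow> of_rat q < \<alpha> \<longrightarrow> cov n p q s"
    and computable_cov:
      "computable (\<lambda>p. cov (fst p) (fst (snd p)) (fst (snd (snd p))) (snd (snd (snd p))))"
    and U_sets: "U n \<in> sets lborel"
    and U_measure: "emeasure lborel (U n) \<le> ennreal (1 / 2 ^ n)"
    and not_computable: "\<not> computable_real \<alpha>"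
begin

text \<open>In terms of signed values: the largest rational listed so far agrees with the current
  difference up to the precision \<open>1 / 2 ^ cnt L (Suc (idx s))\<close>. All searches are
  bounded by the stage, which keeps the condition decidable.\<close>

definition acts :: "nat \<Rightarrow> rat \<Rightarrow> (nat \<times> rat) list \<Rightarrow> bool" where
  "acts s b L \<longleftrightarrow>
    (\<exists>i<s. listed (idx s div 2) i s \<and>
      signed (idx s) (a s - b) - 1 / 2 ^ cnt L (Suc (idx s)) \<le> signed (idx s) (nat_to_rat_surj i)) \<and>
    (\<forall>i<s. listed (idx s div 2) i s \<longrightarrow>
      signed (idx s) (nat_to_rat_surj i) \<le> signed (idx s) (a s - b) + 1 / 2 ^ cnt L (Suc (idx s)))"

text \<open>
  The first entry with index at most \<open>k\<close> has index exactly \<open>k\<close> iff no requirement of higher priority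
  than \<open>k\<close> has acted since \<open>k\<close> did.
\<close>

definition boost :: "nat \<Rightarrow> (nat \<times> rat) list \<Rightarrow> rat" where
  "boost s L = (case filter (\<lambda>p. fst p \<le> idx s) L of [] \<Rightarrow> 0 | p # _ \<Rightarrow>
    if even (idx s) \<and> fst p = idx s \<and> cov (idx s + cnt L (idx s)) (snd p) (a s) s
    then (a s - snd p) + (a s - snd p) else 0)"

definition step :: "nat \<Rightarrow> rat \<times> (nat \<times> rat) list \<Rightarrow> rat \<times> (nat \<times> rat) list" where
  "step s r = (if acts s (fst r) (snd r) then (fst r + boost s (snd r), (idx s, a s) # snd r) else r)"

definition "state = rec_nat (0, []) step"
definition "b s = fst (state s)"
definition "hist s = snd (state s)"
definition "act s \<longleftrightarrow> acts s (b s) (hist s)"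
definition "c k s = cnt (hist s) k"
definition "inc s = (if act s then boost s (hist s) else 0)"

lemma state_Suc: "state (Suc s) = step s (state s)"
  by (simp add: state_def)

lemma b_Suc: "b (Suc s) = b s + inc s"
  by (simp add: b_def state_Suc step_def inc_def act_def hist_def)

lemma hist_Suc: "hist (Suc s) = (if act s then (idx s, a s) # hist s else hist s)"
  by (simp add: b_def state_Suc step_def act_def hist_def)

lemma hist_0: "hist 0 = []" and b_0: "b 0 = 0"
  by (simp_all add: hist_def b_def state_def)

lemma c_Suc: "c k (Suc s) = c k s + of_bool (act s \<and> idx s < k)"
  by (simp add: c_def hist_Suc cnt_def)

lemma c_mono: "s \<le> t \<Longrightarrow> c k s \<le> c k t"
  by (rule lift_Suc_mono_le[of "c k"]) (auto simp: c_Suc)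

lemma c_mono_index: "j \<le> k \<Longrightarrow> c j s \<le> c k s"
  unfolding c_def by (rule cnt_mono)

lemma hist_le: "p \<in> set (hist s) \<Longrightarrow> snd p \<le> a s"
proof (induction s)
  case (Suc s)
  then show ?case using a_mono[of s "Suc s"] by (force simp: hist_Suc split: if_splits)
qed (simp add: hist_0)

lemma boost_nonneg: "0 \<le> boost s (hist s)"
proof (cases "filter (\<lambda>p. fst p \<le> idx s) (hist s)")
  case (Cons p ps)
  then have "p \<in> set (hist s)" by (metis filter_is_subset list.set_intros(1) subsetD)
  with Cons hist_le[of p s] show ?thesis by (simp add: boost_def)
qed (simp add: boost_def)

lemma inc_nonneg: "0 \<le> inc s"
  by (simp add: inc_def boost_nonneg)

lemma inc_nonzero: "inc s \<noteq> 0 \<Longrightarrow> act s \<and> even (idx s)"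
  by (auto simp: inc_def boost_def split: if_splits list.splits)

lemma b_mono: "s \<le> t \<Longrightarrow> b s \<le> b t"
  by (rule lift_Suc_mono_le[of b]) (simp add: b_Suc inc_nonneg)

subsection \<open>Computability of the construction\<close>

lemma computable_a': "computable f \<Longrightarrow> computable (\<lambda>x. a (f x))"
  by (rule computable_compose[OF computable_a])

lemma computable_cov':
  assumes "computable f" "computable g" "computable h" "computable k"
  shows "computable (\<lambda>x. cov (f x) (g x) (h x) (k x))"
  using computable_compose[OF computable_cov
      computable_Pair[OF assms(1) computable_Pair[OF assms(2) computable_Pair[OF assms(3,4)]]]]
  by simp

lemma computable_idx: "computable f \<Longrightarrow> computable (\<lambda>x. idx (f x))"
  unfolding idx_def by (intro computable_intros)

lemma computable_cnt: "computable f \<Longrightarrow> computable g \<Longrightarrow> computable (\<lambda>x. cnt (f x) (g x))"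
  by (rule computable_compose2[of cnt]) (unfold cnt_def, intro computable_intros)

lemma computable_listed:
  assumes "computable f" "computable g" "computable h"
  shows "computable (\<lambda>x. listed (f x) (g x) (h x))"
proof -
  have "computable (\<lambda>p. listed (fst p) (fst (snd p)) (snd (snd p)))"
    unfolding listed_def by (intro computable_intros computable_halts)
  from computable_compose[OF this computable_Pair[OF assms(1) computable_Pair[OF assms(2,3)]]]
  show ?thesis by simp
qed

lemma computable_acts:
  assumes "computable f" "computable g" "computable h"
  shows "computable (\<lambda>x. acts (f x) (g x) (h x))"
proof -
  have "computable (\<lambda>p. acts (fst p) (fst (snd p)) (snd (snd p)))"
    unfolding acts_def
    by (intro computable_rat_intros computable_listed computable_signed computable_idx
        computable_cnt computable_a')
  from computable_compose[OF this computable_Pair[OF assms(1) computable_Pair[OF assms(2,3)]]]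
  show ?thesis by simp
qed

lemma computable_boost:
  "computable f \<Longrightarrow> computable g \<Longrightarrow> computable (\<lambda>x. boost (f x) (g x))"
  by (rule computable_compose2[of boost])
    (unfold boost_def, intro computable_case_list computable_rat_intros computable_cov'
      computable_idx computable_cnt computable_a')

lemma computable_state: "computable f \<Longrightarrow> computable (\<lambda>x. state (f x))"
proof (rule computable_compose[of state])
  have "computable (\<lambda>s. rec_nat (0, []) (\<lambda>i r. step i r) s)"
    unfolding step_def
    by (intro computable_rec_nat computable_rat_intros computable_acts computable_boost
        computable_idx computable_a')
  then show "computable state" by (simp add: state_def)
qed

lemma computable_b: "computable f \<Longrightarrow> computable (\<lambda>x. b (f x))"
  unfolding b_def by (intro computable_intros computable_state)

lemma computable_act: "computable f \<Longrightarrow> computable (\<lambda>x. act (f x))"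
  unfolding act_def hist_def by (intro computable_intros computable_state computable_acts computable_b)

lemma computable_c: "computable f \<Longrightarrow> computable g \<Longrightarrow> computable (\<lambda>x. c (f x) (g x))"
  unfolding c_def hist_def by (intro computable_cnt computable_snd computable_state)

subsection \<open>The cost of the construction\<close>

text \<open>
  The intervals between consecutive visits of the requirement \<open>k\<close> that get boosted at level \<open>n\<close>
  are disjoint and contained in \<open>U n\<close>.
\<close>

lemma cost_le:
  "(\<Sum>u<s. if idx u = k \<and> k + c k u = n then of_rat (inc u) else 0) \<le> (2 / 2 ^ n :: real)"
proof -
  let ?f = "\<lambda>u. if idx u = k \<and> k + c k u = n then of_rat (inc u) else (0::real)"
  let ?\<mu> = "\<lambda>x::rat. measure lborel (U n \<inter> {..<of_rat x})"
  have fin: "U n \<inter> A \<in> fmeasurable lborel" if "A \<in> sets lborel" for A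
  proof (rule fmeasurableI)
    show "U n \<inter> A \<in> sets lborel" using U_sets that by blast
    show "emeasure lborel (U n \<inter> A) < \<infinity>"
      using emeasure_mono[of "U n \<inter> A" "U n" lborel] U_sets[of n] U_measure[of n]
      by (metis ennreal_less_top inf_le1 infinity_ennreal_def order_le_less_trans)
  qed
  have sets: "U n \<inter> {..<of_rat x} \<in> sets lborel" for x :: rat
    using U_sets[of n] by simp
  have mono: "?\<mu> x \<le> ?\<mu> y" if "x \<le> y" for x y
    using that by (intro measure_mono_fmeasurable fin sets)
      (auto simp: of_rat_less_eq intro: less_le_trans)
  \<comment> \<open>The interval from \<open>x\<close> to \<open>y\<close> lies in
    \<open>U n\<close> and is disjoint from the part of \<open>U n\<close> to the left of
    \<open>x\<close>, so its whole length is gained.\<close>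
  have jump: "?\<mu> x + of_rat (y - x) \<le> ?\<mu> y"
    if "{of_rat x..of_rat y} \<subseteq> U n" "x \<le> y" for x y
  proof -
    have xy: "(of_rat x :: real) \<le> of_rat y" using that(2) by (simp add: of_rat_less_eq)
    have "?\<mu> x + measure lborel {of_rat x..<of_rat y :: real}
        = measure lborel ((U n \<inter> {..<of_rat x}) \<union> {of_rat x..<of_rat y})"
      using fin[of "{..<of_rat x}"] xy by (intro measure_Union[symmetric]) (auto simp: fmeasurable_def)
    also have "\<dots> \<le> ?\<mu> y"
      using that(1) xy U_sets[of n] by (intro measure_mono_fmeasurable fin) auto
    finally show ?thesis using xy by (simp add: of_rat_diff)
  qed
  \<comment> \<open>Invariant: the cost so far is at most twice the measure of \<open>U n\<close> to
    the left of the value recorded at the last action of \<open>k\<close>. The first alternative is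
    for the time before \<open>k\<close> has acted.\<close>
  have "(\<Sum>u<s. ?f u) \<le> 0 \<or> (\<exists>p ps. filter (\<lambda>p. fst p = k) (hist s) = p # ps \<and>
      (\<Sum>u<s. ?f u) \<le> 2 * ?\<mu> (snd p))"
  proof (induction s)
    case (Suc s)
    show ?case
    proof (cases "act s \<and> idx s = k")
      case False
      then have "?f s = 0" "filter (\<lambda>p. fst p = k) (hist (Suc s)) = filter (\<lambda>p. fst p = k) (hist s)"
        by (auto simp: hist_Suc inc_def)
      with Suc show ?thesis by simp
    next
      case True
      then have new: "filter (\<lambda>p. fst p = k) (hist (Suc s)) = (k, a s) # filter (\<lambda>p. fst p = k) (hist s)"
        by (simp add: hist_Suc)
      have old: "snd p \<le> a s" if "filter (\<lambda>p. fst p = k) (hist s) = p # ps" for p ps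
        using that hist_le by (metis filter_is_subset list.set_intros(1) subsetD)
      have le: "(\<Sum>u<s. ?f u) \<le> 2 * ?\<mu> x"
        if x: "\<And>p ps. filter (\<lambda>p. fst p = k) (hist s) = p # ps \<Longrightarrow> snd p \<le> x" for x
        using Suc
      proof (elim disjE exE conjE)
        assume "(\<Sum>u<s. ?f u) \<le> 0"
        moreover have "0 \<le> 2 * ?\<mu> x" by simp
        ultimately show ?thesis by (rule order_trans)
      next
        fix p ps
        assume "filter (\<lambda>p. fst p = k) (hist s) = p # ps" and "(\<Sum>u<s. ?f u) \<le> 2 * ?\<mu> (snd p)"
        moreover from this(1) have "?\<mu> (snd p) \<le> ?\<mu> x" by (intro mono x)
        ultimately show ?thesis by linarith
      qed
      have "(\<Sum>u<Suc s. ?f u) \<le> 2 * ?\<mu> (a s)"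
      proof (cases "?f s = 0")
        case f0: True
        have "(\<Sum>u<Suc s. ?f u) = (\<Sum>u<s. ?f u) + ?f s" by simp
        with f0 le[of "a s"] old show ?thesis by simp
      next
        case False
        then have "boost s (hist s) \<noteq> 0" "k + c k s = n"
          by (auto simp: inc_def split: if_splits)
        then obtain p ps where p: "filter (\<lambda>p. fst p \<le> k) (hist s) = p # ps" "fst p = k"
          "cov n (snd p) (a s) s" "boost s (hist s) = (a s - snd p) + (a s - snd p)"
          using True by (auto simp: boost_def c_def split: list.splits if_splits)
        \<comment> \<open>The entry used by \<open>boost\<close>, the first of index at most
          \<open>k\<close>, has index \<open>k\<close>; hence it is the very entry of which the
          invariant speaks.\<close>
        have "filter (\<lambda>p. fst p = k) (hist s) = filter (\<lambda>p. fst p = k) (filter (\<lambda>p. fst p \<le> k) (hist s))"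
          by (auto simp: conj_commute intro: filter_cong)
        with p(1,2) have hd: "filter (\<lambda>p. fst p = k) (hist s) = p # filter (\<lambda>p. fst p = k) ps"
          by simp
        have "(\<Sum>u<s. ?f u) \<le> 2 * ?\<mu> (snd p)"
          by (rule le) (use hd in auto)
        moreover have "?f s = 2 * of_rat (a s - snd p)"
          using True p(4) \<open>k + c k s = n\<close> by (simp add: inc_def of_rat_mult of_rat_diff)
        moreover have "?\<mu> (snd p) + of_rat (a s - snd p) \<le> ?\<mu> (a s)"
          using cov_sound[OF p(3)] old[OF hd] by (rule jump)
        ultimately show ?thesis by simp
      qed
      with new show ?thesis by auto
    qed
  qed simp
  moreover have "2 * ?\<mu> x \<le> 2 / 2 ^ n" for x
  proof -
    have "emeasure lborel (U n \<inter> {..<of_rat x}) \<le> ennreal (1 / 2 ^ n)"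
      using emeasure_mono[of "U n \<inter> {..<of_rat x}" "U n" lborel] U_sets U_measure[of n]
      by (meson inf_le1 order_trans)
    then have "?\<mu> x \<le> 1 / 2 ^ n" unfolding measure_def by (intro enn2real_leI) auto
    then show ?thesis by simp
  qed
  moreover have "0 \<le> (2 / 2 ^ n :: real)" by simp
  ultimately show ?thesis
    by (elim disjE exE conjE) (linarith, force elim: order_trans)
qed

lemma b_diff: "s \<le> t \<Longrightarrow> b t - b s = (\<Sum>u\<in>{s..<t}. inc u)"
  by (induction rule: dec_induct) (simp_all add: b_Suc algebra_simps)

text \<open>Counts only grow, so an increment made from stage \<open>s\<close> on by a requirement
  \<open>k\<close> with \<open>m \<le> k\<close> is made at a level \<open>n\<close> of at least
  \<open>k + c m s\<close>. By \<open>cost_le\<close> each pair of \<open>k\<close> and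
  \<open>n\<close> costs at most \<open>2 / 2 ^ n\<close>, and summing the two geometric series
  gives the bound.\<close>

lemma tail_le:
  assumes "s \<le> t" and m: "\<And>u. s \<le> u \<Longrightarrow> u < t \<Longrightarrow> inc u \<noteq> 0 \<Longrightarrow> m \<le> idx u"
  shows "of_rat (b t) - of_rat (b s) \<le> (8 / 2 ^ (m + c m s) :: real)"
proof -
  \<comment> \<open>\<open>M\<close> and \<open>N\<close> only make the set of pairs finite:
    \<open>N\<close> exceeds all indices and levels that occur before stage
    \<open>t\<close>.\<close>
  define M where "M = Max ((\<lambda>u. c (idx u) u) ` {..t})"
  define N where "N = t + t + Suc M"
  define I where "I = Sigma {m..<N} (\<lambda>k. {k + c m s..<N})"
  let ?key = "\<lambda>u. (idx u, idx u + c (idx u) u)"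
  have key: "?key u \<in> I" if u: "u \<in> {s..<t}" "inc u \<noteq> 0" for u
  proof -
    have "m \<le> idx u" using m u by auto
    moreover have "c m s \<le> c (idx u) u"
      using c_mono[of s u m] c_mono_index[OF \<open>m \<le> idx u\<close>, of u] u(1) by simp
    moreover have "c (idx u) u \<le> M"
      using u unfolding M_def by (intro Max_ge) auto
    ultimately show ?thesis using idx_le[of u] u(1) unfolding I_def N_def by auto
  qed
  have finI: "finite I" by (simp add: I_def)
  have "of_rat (b t) - of_rat (b s) = (\<Sum>u\<in>{s..<t}. of_rat (inc u) :: real)"
    using b_diff[OF assms(1)] by (simp add: of_rat_diff[symmetric] of_rat_sum)
  also have "\<dots> = (\<Sum>u\<in>{s..<t}. \<Sum>q\<in>I. if ?key u = q then of_rat (inc u) else 0)"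
    using key finI by (intro sum.cong refl) (auto simp: sum.delta')
  also have "\<dots> = (\<Sum>q\<in>I. \<Sum>u\<in>{s..<t}. if ?key u = q then of_rat (inc u) else 0)"
    by (rule sum.swap)
  also have "\<dots> \<le> (\<Sum>q\<in>I. 2 / 2 ^ snd q)"
  proof (intro sum_mono)
    fix q
    have "(\<Sum>u\<in>{s..<t}. if ?key u = q then of_rat (inc u) else (0::real))
        \<le> (\<Sum>u<t. if ?key u = q then of_rat (inc u) else 0)"
      by (intro sum_mono2) (auto simp: inc_nonneg)
    also have "\<dots> = (\<Sum>u<t. if idx u = fst q \<and> fst q + c (fst q) u = snd q then of_rat (inc u) else 0)"
      by (intro sum.cong refl) (auto simp: prod_eq_iff)
    also have "\<dots> \<le> 2 / 2 ^ snd q" by (rule cost_le)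
    finally show "(\<Sum>u\<in>{s..<t}. if ?key u = q then of_rat (inc u) else (0::real)) \<le> 2 / 2 ^ snd q" .
  qed
  also have "\<dots> = (\<Sum>k\<in>{m..<N}. \<Sum>n\<in>{k + c m s..<N}. 2 / 2 ^ n)"
    unfolding I_def by (subst sum.Sigma) (auto simp: case_prod_beta)
  also have "\<dots> \<le> (\<Sum>k\<in>{m..<N}. 4 / 2 ^ c m s * (1 / 2 ^ k))"
  proof (intro sum_mono)
    fix k
    show "(\<Sum>n\<in>{k + c m s..<N}. 2 / 2 ^ n) \<le> (4 / 2 ^ c m s * (1 / 2 ^ k) :: real)"
      using sum_inverse_power2_le[of "k + c m s" N]
        sum_distrib_left[of "2 :: real" "\<lambda>n. 1 / 2 ^ n" "{k + c m s..<N}"]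
      by (simp add: power_add mult.commute)
  qed
  also have "\<dots> = 4 / 2 ^ c m s * (\<Sum>k\<in>{m..<N}. 1 / 2 ^ k)"
    by (rule sum_distrib_left[symmetric])
  also have "\<dots> \<le> 4 / 2 ^ c m s * (2 / 2 ^ m)"
    by (intro mult_left_mono sum_inverse_power2_le) simp
  also have "\<dots> = 8 / 2 ^ (m + c m s)" by (simp add: power_add)
  finally show ?thesis .
qed

definition "\<beta> = (SUP s. real_of_rat (b s))"

lemma b_lim: "(\<lambda>s. of_rat (b s)) \<longlonglongrightarrow> \<beta>"
  unfolding \<beta>_def
proof (rule LIMSEQ_incseq_SUP)
  have "of_rat (b t) \<le> (8 :: real)" for t
    using tail_le[of 0 t 0] by (simp add: b_0 c_def hist_0 cnt_def)
  then show "bdd_above (range (\<lambda>s. real_of_rat (b s)))" by (auto simp: bdd_above_def)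
  show "incseq (\<lambda>s. real_of_rat (b s))" by (simp add: incseq_def of_rat_less_eq b_mono)
qed

lemma b_le: "of_rat (b s) \<le> \<beta>"
  by (rule incseq_le[OF _ b_lim]) (simp add: incseq_def of_rat_less_eq b_mono)

lemma tail_lim_le:
  assumes "\<And>u. s \<le> u \<Longrightarrow> inc u \<noteq> 0 \<Longrightarrow> m \<le> idx u"
  shows "\<beta> - of_rat (b s) \<le> 8 / 2 ^ (m + c m s)"
proof -
  have "\<beta> \<le> 8 / 2 ^ (m + c m s) + of_rat (b s)"
  proof (rule LIMSEQ_le_const2[OF b_lim], intro exI[of _ s] allI impI)
    fix t assume "s \<le> t"
    then show "real_of_rat (b t) \<le> 8 / 2 ^ (m + c m s) + of_rat (b s)"
      using tail_le[of s t m] assms by auto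
  qed
  then show ?thesis by simp
qed

subsection \<open>Every requirement acts only finitely often\<close>

text \<open>Each action of \<open>k\<close> raises \<open>c (Suc k)\<close>, so with infinitely many
  actions the precision demanded of \<open>k\<close> tends to 0.\<close>

lemma eventually_c_ge:
  assumes "infinite {s. act s \<and> idx s = k}"
  obtains s0 where "\<And>s. s0 \<le> s \<Longrightarrow> N \<le> c (Suc k) s"
proof -
  have "\<exists>s. N \<le> c (Suc k) s"
  proof (induction N)
    case (Suc N)
    then obtain s where s: "N \<le> c (Suc k) s" ..
    obtain t where "s < t" "act t" "idx t = k"
      using assms unfolding infinite_nat_iff_unbounded by blast
    with s c_mono[of s t "Suc k"] show ?case by (intro exI[of _ "Suc t"]) (simp add: c_Suc)
  qed simp
  then obtain s0 where "N \<le> c (Suc k) s0" ..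
  with that c_mono show thesis by (meson order_trans)
qed

lemma diff_lim: "(\<lambda>s. of_rat (a s) - of_rat (b s)) \<longlonglongrightarrow> \<alpha> - \<beta>"
  by (intro tendsto_diff a_lim b_lim)

lemma signed_diff_lim:
  "(\<lambda>s. signed k (of_rat (a s) - of_rat (b s))) \<longlonglongrightarrow> signed k (\<alpha> - \<beta>)"
  unfolding signed_def using diff_lim tendsto_minus[OF diff_lim] by simp

lemma actsD:
  assumes "act s" and "idx s = k"
  shows "\<exists>i. listed (k div 2) i s \<and> signed k (of_rat (a s) - of_rat (b s)) - 1 / 2 ^ c (Suc k) s
      \<le> (signed k (rat_real i) :: real)"
    and "listed (k div 2) i s \<Longrightarrow> (signed k (rat_real i) :: real)
      \<le> signed k (of_rat (a s) - of_rat (b s)) + 1 / 2 ^ c (Suc k) s"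
proof -
  let ?x = "signed k (a s - b s)" and ?d = "1 / 2 ^ c (Suc k) s :: rat"
  have *: "(of_rat (?x - ?d) :: real) = signed k (of_rat (a s) - of_rat (b s)) - 1 / 2 ^ c (Suc k) s"
    "(of_rat (?x + ?d) :: real) = signed k (of_rat (a s) - of_rat (b s)) + 1 / 2 ^ c (Suc k) s"
    by (simp_all add: of_rat_diff of_rat_add of_rat_signed of_rat_divide of_rat_power)
  show "\<exists>i. listed (k div 2) i s \<and> signed k (of_rat (a s) - of_rat (b s)) - 1 / 2 ^ c (Suc k) s
      \<le> (signed k (rat_real i) :: real)"
    using assms unfolding act_def acts_def *[symmetric] of_rat_signed[symmetric] of_rat_less_eq
    by (auto simp: c_def)
  show "(signed k (rat_real i) :: real)
      \<le> signed k (of_rat (a s) - of_rat (b s)) + 1 / 2 ^ c (Suc k) s" if "listed (k div 2) i s"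
    using assms that unfolding act_def acts_def *[symmetric] of_rat_signed[symmetric] of_rat_less_eq
    by (auto simp: c_def listed_def)
qed

text \<open>The rational that witnesses the action at \<open>s\<close> stays listed. At later
  actions the upper bound in \<open>acts\<close>, with error tending to 0, forces its signed value
  below the signed limit.\<close>

lemma infinitely_many_acts_bound:
  assumes inf: "infinite {s. act s \<and> idx s = k}" and s: "act s" "idx s = k"
  shows "signed k (of_rat (a s) - of_rat (b s)) - 1 / 2 ^ c (Suc k) s \<le> (signed k (\<alpha> - \<beta>) :: real)"
proof -
  obtain i where i: "listed (k div 2) i s"
    "signed k (of_rat (a s) - of_rat (b s)) - 1 / 2 ^ c (Suc k) s \<le> (signed k (rat_real i) :: real)"
    using actsD(1)[OF s] by blast
  have "signed k (rat_real i) \<le> signed k (\<alpha> - \<beta>)"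
  proof (rule field_le_epsilon)
    fix e :: real assume "0 < e"
    then obtain N where "1 / 2 ^ N < e / 2"
      using real_arch_pow_inv[of "e / 2" "1 / 2"] by (auto simp: power_divide)
    moreover obtain s0 where s0: "\<And>t. s0 \<le> t \<Longrightarrow> N \<le> c (Suc k) t"
      using eventually_c_ge[OF inf] by blast
    moreover obtain s1 where
      s1: "\<And>t. s1 \<le> t \<Longrightarrow> \<bar>signed k (of_rat (a t) - of_rat (b t)) - signed k (\<alpha> - \<beta>)\<bar> < e / 2"
      using LIMSEQ_D[OF signed_diff_lim[of k], of "e / 2"] \<open>0 < e\<close> by auto
    moreover obtain t where t: "s + s0 + s1 < t" "act t" "idx t = k"
      using inf unfolding infinite_nat_iff_unbounded by blast
    moreover have "(1 / 2 ^ c (Suc k) t :: real) \<le> 1 / 2 ^ N"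
      using s0[of t] t(1) by (simp add: frac_le)
    moreover have "signed k (rat_real i) \<le> signed k (of_rat (a t) - of_rat (b t)) + (1 / 2 ^ c (Suc k) t :: real)"
      using listed_mono[OF i(1), of t] t by (intro actsD(2)) auto
    ultimately show "signed k (rat_real i) \<le> signed k (\<alpha> - \<beta>) + e"
      using s1[of t] by linarith
  qed
  with i(2) show ?thesis by linarith
qed

text \<open>After \<open>s0\<close> no action of higher priority occurs, so the level of
  \<open>k\<close> is fixed. Once the approximations have entered an interval of that level around
  \<alpha>, every action of \<open>k\<close> after another one is boosted, and the boosts telescope
  to twice the growth of \<alpha>.\<close>

lemma even_acts_growth:
  assumes k: "even k" and inf: "infinite {s. act s \<and> idx s = k}"
    and quiet: "\<And>s. s0 \<le> s \<Longrightarrow> act s \<Longrightarrow> k \<le> idx s"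
  obtains s1 where "\<And>s. s1 \<le> s \<Longrightarrow> act s \<Longrightarrow> idx s = k \<Longrightarrow>
    2 * (\<alpha> - of_rat (a s)) \<le> \<beta> - of_rat (b s)"
proof -
  let ?n = "k + c k s0"
  obtain x s1 where "x < \<alpha>"
    and cov: "\<And>s p q. s1 \<le> s \<Longrightarrow> x < of_rat p \<Longrightarrow> of_rat q < \<alpha> \<Longrightarrow> cov ?n p q s"
    using cov_complete[of ?n] by blast
  obtain s2 where s2: "\<And>s. s2 \<le> s \<Longrightarrow> x < of_rat (a s)"
    using order_tendstoD(1)[OF a_lim \<open>x < \<alpha>\<close>] unfolding eventually_sequentially by blast
  have c_const: "c k s = c k s0" if "s0 \<le> s" for s
    using that
  proof (induction rule: dec_induct)
    case (step s)
    then show ?case using quiet[of s] by (auto simp: c_Suc)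
  qed simp
  show thesis
  proof (rule that)
    fix s assume s: "s0 + s1 + s2 \<le> s" "act s" "idx s = k"
    \<comment> \<open>Invariant following an action at \<open>s\<close>: the entry that the next
      boost will use belongs to \<open>k\<close>, lies in the covered range, and the boosts have
      already paid for the way from \<open>a s\<close> to it.\<close>
    have run: "\<exists>p ps. filter (\<lambda>p. fst p \<le> k) (hist t) = p # ps \<and> fst p = k \<and> x < of_rat (snd p) \<and>
        2 * (of_rat (snd p) - of_rat (a s)) \<le> (of_rat (b t) - of_rat (b s) :: real) \<and>
        (\<forall>u. s \<le> u \<and> u < t \<and> act u \<and> idx u = k \<longrightarrow> a u \<le> snd p)" if "Suc s \<le> t" for t
      using that
    proof (induction rule: dec_induct)
      case base
      have "a u \<le> a s" if "u < Suc s" for u using that a_mono by simp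
      with s s2[of s] b_mono[of s "Suc s"] show ?case
        by (auto simp: hist_Suc of_rat_less_eq)
    next
      case (step t)
      then obtain p ps where p: "filter (\<lambda>p. fst p \<le> k) (hist t) = p # ps" "fst p = k"
        "x < of_rat (snd p)" "2 * (of_rat (snd p) - of_rat (a s)) \<le> (of_rat (b t) - of_rat (b s) :: real)"
        "\<And>u. s \<le> u \<Longrightarrow> u < t \<Longrightarrow> act u \<Longrightarrow> idx u = k \<Longrightarrow> a u \<le> snd p" by blast
      show ?case
      proof (cases "act t \<and> idx t = k")
        case False
        then have "filter (\<lambda>p. fst p \<le> k) (hist (Suc t)) = p # ps"
          using p(1) quiet[of t] s(1) step(1) by (auto simp: hist_Suc)
        moreover have "(of_rat (b t) :: real) \<le> of_rat (b (Suc t))"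
          by (simp add: of_rat_less_eq b_mono)
        ultimately show ?thesis using p False by (auto simp: less_Suc_eq)
      next
        case True
        have "s1 \<le> t" using s(1) step(1) by linarith
        then have "cov ?n (snd p) (a t) t" using p(3) a_less by (rule cov)
        moreover have "c k t = c k s0" by (rule c_const) (use s(1) step(1) in linarith)
        ultimately have "inc t = (a t - snd p) + (a t - snd p)"
          using True k p(1,2) by (simp add: inc_def boost_def c_def)
        then have "(of_rat (b (Suc t)) :: real)
            = of_rat (b t) + 2 * (of_rat (a t) - of_rat (snd p))"
          by (simp add: b_Suc of_rat_add of_rat_mult of_rat_diff)
        moreover have "x < of_rat (a t)" using s2[of t] s(1) step(1) by simp
        moreover have "a u \<le> a t" if "u < Suc t" for u using a_mono[of u t] that by simp
        ultimately show ?thesis using True p(4) by (auto simp: hist_Suc)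
      qed
    qed
    have "2 * \<alpha> \<le> \<beta> - of_rat (b s) + 2 * of_rat (a s)"
    proof (rule LIMSEQ_le_const2[OF tendsto_mult_left[OF a_lim, of 2]], intro exI[of _ s] allI impI)
      fix u assume "s \<le> u"
      \<comment> \<open>Infinitely many actions are used here: the boosts up to a later action
        \<open>v\<close> account for all growth of the approximation up to
        \<open>a u\<close>.\<close>
      obtain v where v: "u < v" "act v" "idx v = k"
        using inf unfolding infinite_nat_iff_unbounded by blast
      have "Suc s \<le> Suc v" "s \<le> v" using v(1) \<open>s \<le> u\<close> by simp_all
      obtain p :: "nat \<times> rat" where
        p: "2 * (of_rat (snd p) - of_rat (a s)) \<le> (of_rat (b (Suc v)) - of_rat (b s) :: real)"
        "\<forall>u. s \<le> u \<and> u < Suc v \<and> act u \<and> idx u = k \<longrightarrow> a u \<le> snd p"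
        using run[OF \<open>Suc s \<le> Suc v\<close>] by (elim exE conjE) (rule that; assumption)
      have "a v \<le> snd p" using p(2) v(2,3) \<open>s \<le> v\<close> by simp
      have "a u \<le> snd p" using order_trans[OF a_mono \<open>a v \<le> snd p\<close>, of u] v(1) by simp
      then have "(of_rat (a u) :: real) \<le> of_rat (snd p)" by (simp only: of_rat_less_eq)
      with p(1) b_le[of "Suc v"] show "2 * of_rat (a u) \<le> \<beta> - of_rat (b s) + 2 * of_rat (a s)"
        by argo
    qed
    then show "2 * (\<alpha> - of_rat (a s)) \<le> \<beta> - of_rat (b s)" by simp
  qed
qed

text \<open>Let \<open>d\<close> be the precision at \<open>s\<close>. For even \<open>k\<close>,
  \<beta> grows by at least twice the remaining growth of \<alpha>, but exceeds that growth by at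
  most \<open>d\<close>, so the growth is at most \<open>d\<close>. For odd \<open>k\<close>, the
  growth of \<alpha> is at most that of \<beta> plus \<open>d\<close>; as \<open>k\<close> never
  raises \<beta>, only lower priorities do, by at most \<open>8 * d\<close>.\<close>

lemma infinitely_many_acts_close:
  assumes inf: "infinite {s. act s \<and> idx s = k}"
    and quiet: "\<And>s. s0 \<le> s \<Longrightarrow> act s \<Longrightarrow> k \<le> idx s"
  obtains s1 where "\<And>s. s1 \<le> s \<Longrightarrow> act s \<Longrightarrow> idx s = k \<Longrightarrow>
    \<alpha> - of_rat (a s) \<le> 9 / 2 ^ c (Suc k) s"
proof (cases "even k")
  case True
  obtain s1 where s1: "\<And>s. s1 \<le> s \<Longrightarrow> act s \<Longrightarrow> idx s = k \<Longrightarrow>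
    2 * (\<alpha> - of_rat (a s)) \<le> \<beta> - of_rat (b s)"
    using even_acts_growth[OF True inf quiet] by blast
  show thesis
  proof (rule that)
    fix s assume s: "s1 \<le> s" "act s" "idx s = k"
    define d :: real where "d = 1 / 2 ^ c (Suc k) s"
    have "0 \<le> d" by (simp add: d_def)
    moreover have "of_rat (a s) - of_rat (b s) - d \<le> \<alpha> - \<beta>"
      using infinitely_many_acts_bound[OF inf s(2,3)] True by (simp add: signed_def d_def)
    ultimately have "\<alpha> - of_rat (a s) \<le> 9 * d" using s1[OF s] by argo
    then show "\<alpha> - of_rat (a s) \<le> 9 / 2 ^ c (Suc k) s" by (simp add: d_def)
  qed
next
  case False
  show thesis
  proof (rule that)
    fix s assume s: "s0 \<le> s" "act s" "idx s = k"
    have "Suc k \<le> idx u" if "s \<le> u" "inc u \<noteq> 0" for u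
    proof -
      have "k \<le> idx u" "even (idx u)" using quiet[of u] inc_nonzero[OF that(2)] that(1) s(1) by auto
      with False show ?thesis by (metis Suc_leI le_neq_implies_less)
    qed
    then have "\<beta> - of_rat (b s) \<le> 8 / 2 ^ (Suc k + c (Suc k) s)" by (rule tail_lim_le)
    also have "\<dots> \<le> 8 / 2 ^ c (Suc k) s" by (intro divide_left_mono power_increasing) auto
    finally show "\<alpha> - of_rat (a s) \<le> 9 / 2 ^ c (Suc k) s"
      using infinitely_many_acts_bound[OF inf s(2,3)] False by (simp add: signed_def)
  qed
qed

lemma eventually_quiet:
  assumes "\<And>j. j < k \<Longrightarrow> finite {s. act s \<and> idx s = j}"
  obtains s0 where "\<And>s. s0 \<le> s \<Longrightarrow> act s \<Longrightarrow> k \<le> idx s"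
proof -
  have "{s. act s \<and> idx s < k} = (\<Union>j<k. {s. act s \<and> idx s = j})" by auto
  then have "finite {s. act s \<and> idx s < k}" using assms by simp
  then obtain s0 where "\<And>s. act s \<Longrightarrow> idx s < k \<Longrightarrow> s < s0"
    unfolding finite_nat_iff_bounded by blast
  then show thesis by (intro that[of s0]) (metis not_less)
qed

text \<open>Induction on priority. If \<open>k\<close> acted infinitely often, one could wait for an
  action of high precision; the value of \<open>a\<close> there would approximate \<alpha> with a
  known error, making \<alpha> computable.\<close>

lemma finitely_many_acts: "finite {s. act s \<and> idx s = k}"
proof (induction k rule: less_induct)
  case (less k)
  show ?case
  proof (rule ccontr)
    assume inf: "infinite {s. act s \<and> idx s = k}"
    obtain s0 where "\<And>s. s0 \<le> s \<Longrightarrow> act s \<Longrightarrow> k \<le> idx s"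
      using eventually_quiet less by blast
    then obtain s1 where s1: "\<And>s. s1 \<le> s \<Longrightarrow> act s \<Longrightarrow> idx s = k \<Longrightarrow>
      \<alpha> - of_rat (a s) \<le> 9 / 2 ^ c (Suc k) s"
      using infinitely_many_acts_close[OF inf] by blast
    \<comment> \<open>The summand 4 absorbs the factor 9, since 9 is below 16.\<close>
    define P where "P n s \<longleftrightarrow> s1 \<le> s \<and> act s \<and> idx s = k \<and> n + 4 \<le> c (Suc k) s" for n s
    have ex: "\<exists>s. P n s" for n
    proof -
      obtain s2 where "\<And>s. s2 \<le> s \<Longrightarrow> n + 4 \<le> c (Suc k) s"
        using eventually_c_ge[OF inf] by blast
      moreover obtain s where "s1 + s2 < s" "act s" "idx s = k"
        using inf unfolding infinite_nat_iff_unbounded by blast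
      ultimately show ?thesis unfolding P_def by (intro exI[of _ s]) simp
    qed
    have "computable (\<lambda>n. LEAST s. P n s)"
      by (rule computable_Least[OF _ ex], unfold P_def)
        (intro computable_intros computable_act computable_idx computable_c)
    then have "computable (\<lambda>n. enc (a (LEAST s. P n s)))"
      by (intro computable_compose[OF computable_enc] computable_a')
    moreover have "\<bar>\<alpha> - rat_real (enc (a (LEAST s. P n s)))\<bar> \<le> 1 / 2 ^ n" for n
    proof -
      define s where "s = (LEAST s. P n s)"
      have "P n s" unfolding s_def by (rule LeastI_ex[OF ex])
      then have "\<alpha> - of_rat (a s) \<le> 9 / 2 ^ c (Suc k) s" "n + 4 \<le> c (Suc k) s"
        using s1 unfolding P_def by auto
      moreover from this(2) have "(9 / 2 ^ c (Suc k) s :: real) \<le> 9 / 2 ^ (n + 4)"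
        by (intro divide_left_mono power_increasing) auto
      moreover have "(9 / 2 ^ (n + 4) :: real) \<le> 1 / 2 ^ n" by (simp add: power_add field_simps)
      ultimately show ?thesis using a_less[of s] by (simp add: s_def[symmetric])
    qed
    ultimately have "computable_real \<alpha>"
      unfolding computable_real_def computable_nat_iff by blast
    with not_computable show False ..
  qed
qed

lemma c_eventually_constant:
  obtains s0 where "\<And>s. s0 \<le> s \<Longrightarrow> \<not> (act s \<and> idx s < k)" and "\<And>s. s0 \<le> s \<Longrightarrow> c k s = c k s0"
proof -
  obtain s0 where s0: "\<And>s. s0 \<le> s \<Longrightarrow> act s \<Longrightarrow> k \<le> idx s"
    using eventually_quiet finitely_many_acts by blast
  then have quiet: "\<not> (act s \<and> idx s < k)" if "s0 \<le> s" for s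
    using that leD by blast
  have "c k s = c k s0" if "s0 \<le> s" for s
    using that by (induction rule: dec_induct) (use quiet in \<open>auto simp: c_Suc\<close>)
  with quiet that show thesis by blast
qed

subsection \<open>The properties of the limit\<close>

text \<open>Eventually \<open>k\<close> and all higher priorities are quiet and the precision
  \<open>d\<close> is constant. For a true cut, a late enough stage of \<open>k\<close> would meet
  the condition of \<open>acts\<close> at that precision, so \<open>k\<close> would act once
  more.\<close>

lemma not_cut: "\<not> (\<forall>i. (\<exists>n. halts (k div 2) i n) \<longleftrightarrow> signed k (rat_real i) < signed k (\<alpha> - \<beta>))"
proof
  assume cut: "\<forall>i. (\<exists>n. halts (k div 2) i n) \<longleftrightarrow> signed k (rat_real i) < signed k (\<alpha> - \<beta>)"
  obtain s0 where quiet: "\<And>s. s0 \<le> s \<Longrightarrow> \<not> (act s \<and> idx s < Suc k)"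
    and const: "\<And>s. s0 \<le> s \<Longrightarrow> c (Suc k) s = c (Suc k) s0"
    using c_eventually_constant by blast
  define d :: rat where "d = 1 / 2 ^ c (Suc k) s0"
  have "0 < real_of_rat d" by (simp add: d_def)
  \<comment> \<open>Half of \<open>d\<close> is spent on the distance from \<open>q\<close> to the
    limit, the other half on the convergence of \<open>a s - b s\<close>.\<close>
  then obtain q where q: "signed k (\<alpha> - \<beta>) - of_rat d / 2 < of_rat q" "of_rat q < signed k (\<alpha> - \<beta>)"
    using of_rat_dense[of "signed k (\<alpha> - \<beta>) - of_rat d / 2" "signed k (\<alpha> - \<beta>)"] by auto
  define i where "i = enc (signed k q)"
  have i: "signed k (nat_to_rat_surj i) = q" by (simp add: i_def signed_def)
  then have "\<exists>n. halts (k div 2) i n" using cut q(2) by (simp add: of_rat_signed[symmetric])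
  then obtain n where n: "halts (k div 2) i n" ..
  obtain s1 where
    s1: "\<And>s. s1 \<le> s \<Longrightarrow> \<bar>signed k (of_rat (a s) - of_rat (b s)) - signed k (\<alpha> - \<beta>)\<bar> < of_rat d / 2"
    using LIMSEQ_D[OF signed_diff_lim[of k], of "of_rat d / 2"] \<open>0 < real_of_rat d\<close> by auto
  \<comment> \<open>A stage of \<open>k\<close> late enough for quietness (\<open>s0\<close>), for
    convergence (\<open>s1\<close>) and for \<open>i\<close> to be listed (\<open>i\<close>,
    \<open>n\<close>).\<close>
  define s where "s = prod_encode (k, Suc (s0 + s1 + i + n))"
  have s: "idx s = k" "s0 + s1 + i + n < s"
    using le_prod_encode_2[of "Suc (s0 + s1 + i + n)" k] by (simp_all add: s_def)
  have d: "1 / 2 ^ cnt (hist s) (Suc k) = d"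
    using const[of s] s(2) by (simp add: d_def c_def)
  have lim: "\<bar>of_rat (signed k (a s - b s)) - signed k (\<alpha> - \<beta>)\<bar> < of_rat d / 2"
    using s1[of s] s(2) by (simp add: of_rat_signed of_rat_diff)
  have "act s"
    unfolding act_def acts_def s(1) d
  proof (intro conjI)
    have "real_of_rat (signed k (a s - b s) - d) \<le> of_rat q"
      using lim q(1) unfolding of_rat_diff[of _ d] by linarith
    then have "signed k (a s - b s) - d \<le> signed k (nat_to_rat_surj i)"
      by (simp add: i of_rat_less_eq)
    moreover have "listed (k div 2) i s" using n s(2) unfolding listed_def by (auto intro!: exI[of _ n])
    ultimately show "\<exists>i<s. listed (k div 2) i s \<and>
        signed k (a s - b s) - d \<le> signed k (nat_to_rat_surj i)"
      using s(2) by (intro exI[of _ i]) simp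
    show "\<forall>i<s. listed (k div 2) i s \<longrightarrow> signed k (nat_to_rat_surj i) \<le> signed k (a s - b s) + d"
    proof (intro allI impI)
      fix j assume "listed (k div 2) j s"
      then have "signed k (rat_real j) < signed k (\<alpha> - \<beta>)" using cut unfolding listed_def by blast
      then have "real_of_rat (signed k (nat_to_rat_surj j)) \<le> of_rat (signed k (a s - b s) + d)"
        using lim \<open>0 < real_of_rat d\<close> unfolding of_rat_add of_rat_signed by linarith
      then show "signed k (nat_to_rat_surj j) \<le> signed k (a s - b s) + d"
        by (simp only: of_rat_less_eq)
    qed
  qed
  with quiet[of s] s show False by simp
qed

lemma not_left_ce: "\<not> left_ce (\<alpha> - \<beta>)"
proof
  assume "left_ce (\<alpha> - \<beta>)"
  then obtain e where "\<And>i. rat_real i < \<alpha> - \<beta> \<longleftrightarrow> (\<exists>n. halts e i n)"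
    unfolding left_ce_def ce_rat_set_def using ce_set_halts by (metis (no_types, lifting) mem_Collect_eq)
  with not_cut[of "2 * e"] show False by (simp add: signed_def)
qed

lemma not_right_ce: "\<not> right_ce (\<alpha> - \<beta>)"
proof
  assume "right_ce (\<alpha> - \<beta>)"
  then obtain e where "\<And>i. \<alpha> - \<beta> < rat_real i \<longleftrightarrow> (\<exists>n. halts e i n)"
    unfolding right_ce_def ce_rat_set_def using ce_set_halts by (metis (no_types, lifting) mem_Collect_eq)
  moreover have "signed (Suc (2 * e)) (rat_real i) < signed (Suc (2 * e)) (\<alpha> - \<beta>) \<longleftrightarrow>
      \<alpha> - \<beta> < rat_real i" for i
    by (auto simp: signed_def)
  ultimately show False using not_cut[of "Suc (2 * e)"] by simp
qed

lemma left_ce_\<beta>: "left_ce \<beta>"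
proof -
  have "{n. nat_to_rat_surj n \<in> {q. of_rat q < \<beta>}} = {n. \<exists>s. nat_to_rat_surj n < b s}"
  proof safe
    fix n assume "rat_real n < \<beta>"
    then obtain s where "rat_real n < of_rat (b s)"
      using order_tendstoD(1)[OF b_lim] unfolding eventually_sequentially by blast
    then show "\<exists>s. nat_to_rat_surj n < b s" by (auto simp: of_rat_less)
  next
    fix n s assume "nat_to_rat_surj n < b s"
    then show "rat_real n < \<beta>" using b_le[of s] by (meson less_le_trans of_rat_less)
  qed
  moreover have "ce_set {n. \<exists>s. nat_to_rat_surj n < b s}"
    by (rule ce_set_Ex) (intro computable_rat_intros computable_b)
  ultimately show ?thesis unfolding left_ce_def ce_rat_set_def by simp
qed

text \<open>
  The \<open>m\<close>-th component of the test consists of balls around \<open>b s\<close> so large that \<open>\<beta>\<close> can only leave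
  them through an action of one of the first \<open>m + 7\<close> requirements.
\<close>

definition radius :: "nat \<Rightarrow> nat \<Rightarrow> rat" where
  "radius m s = 1 / 2 ^ (m + 3 + c (m + 7) s)"

definition "test_codes = {x. \<exists>s.
  nat_to_rat_surj (fst (prod_decode (snd (prod_decode x)))) = b s - radius (fst (prod_decode x)) s \<and>
  nat_to_rat_surj (snd (prod_decode (snd (prod_decode x)))) = b s + radius (fst (prod_decode x)) s}"

lemma ce_set_test_codes: "ce_set test_codes"
  unfolding test_codes_def radius_def
  by (rule ce_set_Ex) (intro computable_rat_intros computable_b computable_c)

lemma coded_open_test_codes:
  "coded_open test_codes m = (\<Union>s. {of_rat (b s - radius m s)<..<of_rat (b s + radius m s)})"
    (is "?L = ?R")
proof
  show "?L \<subseteq> ?R"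
    by (fastforce simp: coded_open_def test_codes_def)
  show "?R \<subseteq> ?L"
  proof
    fix x assume "x \<in> ?R"
    then obtain s where "x \<in> {of_rat (b s - radius m s)<..<of_rat (b s + radius m s)}" by blast
    then have "x \<in> {rat_real (enc (b s - radius m s))<..<rat_real (enc (b s + radius m s))}" by simp
    moreover have "prod_encode (m, prod_encode (enc (b s - radius m s), enc (b s + radius m s))) \<in> test_codes"
      by (auto simp: test_codes_def)
    ultimately show "x \<in> ?L" unfolding coded_open_def by blast
  qed
qed

text \<open>After the last action of the first \<open>m + 7\<close> requirements, \<beta> moves by
  at most \<open>8 / 2 ^ (m + 7 + c (m + 7) s)\<close>, which is half of the radius.\<close>

lemma \<beta>_in_test: "\<beta> \<in> coded_open test_codes m"
proof -
  obtain s where s: "\<And>t. s \<le> t \<Longrightarrow> \<not> (act t \<and> idx t < m + 7)"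
    using c_eventually_constant by blast
  have "\<beta> - of_rat (b s) \<le> 8 / 2 ^ (m + 7 + c (m + 7) s)"
    by (rule tail_lim_le) (use s inc_nonzero in \<open>metis not_less\<close>)
  also have "\<dots> < 1 / 2 ^ (m + 3 + c (m + 7) s)"
    by (simp add: power_add field_simps)
  also have "\<dots> = of_rat (radius m s)"
    by (simp add: radius_def of_rat_divide of_rat_power)
  finally have "\<beta> - of_rat (b s) < of_rat (radius m s)" .
  moreover have "0 < real_of_rat (radius m s)" by (simp add: radius_def)
  ultimately show ?thesis
    using b_le[of s] unfolding coded_open_test_codes by (auto simp: of_rat_diff of_rat_add intro!: exI[of _ s])
qed

text \<open>
  While \<open>c (m + 7)\<close> keeps its value \<open>j\<close>, the centers of the balls move by less than their radius.
\<close>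

lemma emeasure_test: "emeasure lborel (coded_open test_codes m) \<le> ennreal (1 / 2 ^ m)"
proof -
  define s0 where "s0 j = (LEAST s. c (m + 7) s = j)" for j
  \<comment> \<open>For a value \<open>j\<close> that is attained, the centers start at
    \<open>b (s0 j)\<close> and move right by at most one radius, so \<open>B j\<close> with a
    length of three radii contains all balls of count \<open>j\<close>. Over all \<open>j\<close>
    the lengths sum to \<open>6 / 2 ^ (m + 3)\<close>. For other \<open>j\<close> the stage
    \<open>s0 j\<close> is arbitrary and the length is the same.\<close>
  define B where "B j = {of_rat (b (s0 j)) - 1 / 2 ^ (m + 3 + j)..of_rat (b (s0 j)) + 2 * (1 / 2 ^ (m + 3 + j)) :: real}"
    for j
  have "coded_open test_codes m \<subseteq> (\<Union>j. B j)"
  proof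
    fix x assume "x \<in> coded_open test_codes m"
    then obtain s where x: "of_rat (b s - radius m s) < x" "x < of_rat (b s + radius m s)"
      unfolding coded_open_test_codes by auto
    define j where "j = c (m + 7) s"
    have s0: "c (m + 7) (s0 j) = j" "s0 j \<le> s"
      unfolding s0_def j_def by (rule LeastI, rule refl, rule Least_le, rule refl)
    \<comment> \<open>An increment by one of the first \<open>m + 7\<close> requirements would raise
      the count, which equals \<open>j\<close> both at \<open>s0 j\<close> and at
      \<open>s\<close>.\<close>
    have "m + 7 \<le> idx u" if u: "s0 j \<le> u" "u < s" "inc u \<noteq> 0" for u
    proof (rule ccontr)
      assume "\<not> m + 7 \<le> idx u"
      then have "c (m + 7) (Suc u) = Suc (c (m + 7) u)"
        using inc_nonzero[OF u(3)] by (simp add: c_Suc)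
      moreover have "j \<le> c (m + 7) u" "c (m + 7) (Suc u) \<le> j"
        using c_mono[of "s0 j" u "m + 7"] c_mono[of "Suc u" s "m + 7"] u s0(1) by (auto simp: j_def)
      ultimately show False by simp
    qed
    then have "of_rat (b s) - of_rat (b (s0 j)) \<le> (8 / 2 ^ (m + 7 + j) :: real)"
      using tail_le[OF s0(2), of "m + 7"] s0(1) by simp
    moreover have "(8 / 2 ^ (m + 7 + j) :: real) \<le> 1 / 2 ^ (m + 3 + j)"
      by (simp add: power_add field_simps)
    moreover have "real_of_rat (radius m s) = 1 / 2 ^ (m + 3 + j)"
      by (simp add: radius_def j_def of_rat_divide of_rat_power)
    moreover have "(of_rat (b (s0 j)) :: real) \<le> of_rat (b s)"
      using s0(2) by (simp add: of_rat_less_eq b_mono)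
    ultimately have "x \<in> B j" using x unfolding B_def of_rat_diff of_rat_add by auto
    then show "x \<in> (\<Union>j. B j)" by blast
  qed
  then have "emeasure lborel (coded_open test_codes m) \<le> emeasure lborel (\<Union>j. B j)"
    by (rule emeasure_mono) (auto simp: B_def)
  also have "\<dots> \<le> (\<Sum>j. emeasure lborel (B j))"
    by (rule emeasure_subadditive_countably) (auto simp: B_def)
  also have "\<dots> = (\<Sum>j. ennreal (3 / 2 ^ (m + 3) * (1 / 2) ^ j))"
  proof (rule suminf_cong)
    fix j
    define d :: real where "d = 1 / 2 ^ (m + 3 + j)"
    have "0 \<le> d" by (simp add: d_def)
    then have "emeasure lborel (B j) = ennreal (3 * d)"
      unfolding B_def d_def[symmetric] by (subst emeasure_lborel_Icc) simp_all
    also have "3 * d = 3 / 2 ^ (m + 3) * (1 / 2) ^ j"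
      by (simp add: d_def power_add power_divide)
    finally show "emeasure lborel (B j) = ennreal (3 / 2 ^ (m + 3) * (1 / 2) ^ j)" .
  qed
  also have "\<dots> = ennreal (3 / 2 ^ (m + 3) * (1 / (1 - 1 / 2)))"
    by (intro suminf_ennreal_eq sums_mult geometric_sums) auto
  also have "\<dots> \<le> ennreal (1 / 2 ^ m)"
    by (intro ennreal_leI) (simp add: power_add field_simps)
  finally show ?thesis .
qed

lemma not_random_\<beta>: "\<not> martin_loef_random \<beta>"
proof -
  have "martin_loef_test (coded_open test_codes)"
    unfolding martin_loef_test_def using ce_set_test_codes emeasure_test by blast
  with \<beta>_in_test show ?thesis unfolding martin_loef_random_def by blast
qed

end

section \<open>Existence of the data of the construction\<close>

text \<open>A running maximum of the rationals found in the left cut, with one candidate certificate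
  checked per stage. All its values lie in the cut, hence strictly below \<alpha>.\<close>

lemma left_ce_approximation:
  assumes "left_ce \<alpha>"
  obtains a :: "nat \<Rightarrow> rat" where "computable a" and "\<And>s t. s \<le> t \<Longrightarrow> a s \<le> a t"
    and "\<And>s. of_rat (a s) < \<alpha>" and "(\<lambda>s. of_rat (a s)) \<longlonglongrightarrow> \<alpha>"
proof -
  obtain e where e: "\<And>i. rat_real i < \<alpha> \<longleftrightarrow> (\<exists>n. halts e i n)"
    using assms unfolding left_ce_def ce_rat_set_def
    using ce_set_halts by (metis (no_types, lifting) mem_Collect_eq)
  obtain q0 where q0: "of_rat q0 < \<alpha>" using of_rat_dense[of "\<alpha> - 1" \<alpha>] by auto
  define new where "new s = nat_to_rat_surj (fst (prod_decode s))" for s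
  define ok where "ok s \<longleftrightarrow> halts e (fst (prod_decode s)) (snd (prod_decode s))" for s
  define a where "a = rec_nat q0 (\<lambda>s r. if ok s \<and> r < new s then new s else r)"
  have a_Suc: "a (Suc s) = (if ok s \<and> a s < new s then new s else a s)" for s
    by (simp add: a_def)
  have "computable (\<lambda>s. rec_nat q0 (\<lambda>s r. if ok s \<and> r < new s then new s else r) s)"
    unfolding ok_def new_def by (intro computable_rec_nat computable_rat_intros computable_halts)
  then have 1: "computable a" by (simp add: a_def)
  have 2: "a s \<le> a t" if "s \<le> t" for s t
    by (rule lift_Suc_mono_le[of a, OF _ that]) (simp add: a_Suc)
  have 3: "of_rat (a s) < \<alpha>" for s
  proof (induction s)
    case 0
    show ?case by (simp add: a_def q0)
  next
    case (Suc s)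
    have "of_rat (new s) < \<alpha>" if "ok s" using that e unfolding ok_def new_def by blast
    with Suc show ?case by (simp add: a_Suc)
  qed
  have "(\<lambda>s. of_rat (a s)) \<longlonglongrightarrow> \<alpha>"
  proof (rule order_tendstoI)
    fix x assume "x < \<alpha>"
    then obtain q where q: "x < of_rat q" "of_rat q < \<alpha>" using of_rat_dense by blast
    then obtain n where n: "halts e (enc q) n" using e[of "enc q"] by auto
    define s where "s = prod_encode (enc q, n)"
    have "q \<le> a (Suc s)" using n by (auto simp: a_Suc ok_def new_def s_def)
    then have "q \<le> a t" if "Suc s \<le> t" for t using 2[OF that] by simp
    then have "x < of_rat (a t)" if "Suc s \<le> t" for t
      using q(1) that by (meson less_le_trans of_rat_less_eq)
    then show "\<forall>\<^sub>F t in sequentially. x < of_rat (a t)" unfolding eventually_sequentially by blast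
  next
    fix x assume "\<alpha> < x"
    then show "\<forall>\<^sub>F t in sequentially. of_rat (a t) < x"
      by (intro always_eventually allI less_trans[OF 3])
  qed
  with 1 2 3 that show thesis by blast
qed

theorem lemma1p2:
  fixes \<alpha> :: real
  assumes "left_ce \<alpha>"
    and "\<not> computable_real \<alpha>"
    and "\<not> martin_loef_random \<alpha>"
  shows "\<exists>\<beta>::real. left_ce \<beta> \<and> \<not> martin_loef_random \<beta> \<and>
           \<not> left_ce (\<alpha> - \<beta>) \<and> \<not> right_ce (\<alpha> - \<beta>)"
proof -
  obtain a where a: "computable a" "\<And>s t. s \<le> t \<Longrightarrow> a s \<le> a t"
    "\<And>s. of_rat (a s) < \<alpha>" "(\<lambda>s. of_rat (a s)) \<longlonglongrightarrow> \<alpha>"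
    using left_ce_approximation[OF assms(1)] by blast
  obtain W where W: "ce_set W" and \<alpha>: "\<And>n. \<alpha> \<in> coded_open W n"
    and measure: "\<And>n. emeasure lborel (coded_open W n) \<le> ennreal (1 / 2 ^ n)"
    using assms(3) unfolding martin_loef_random_def martin_loef_test_def by blast
  obtain e where e: "\<And>x. x \<in> W \<longleftrightarrow> (\<exists>c. halts e x c)" using ce_set_halts[OF W] by blast
  \<comment> \<open>The points \<open>p\<close> and \<open>q\<close> must lie in one and the same
    listed interval, so that everything between them lies in \<open>U n\<close> as well.\<close>
  define cov where "cov n p q s \<longleftrightarrow> (\<exists>i<s. \<exists>j<s. \<exists>c<s.
    halts e (prod_encode (n, prod_encode (i, j))) c \<and> nat_to_rat_surj i < p \<and> q < nat_to_rat_surj j)"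
    for n s :: nat and p q
  interpret construction \<alpha> a "coded_open W" cov
  proof
    show "computable (\<lambda>p. cov (fst p) (fst (snd p)) (fst (snd (snd p))) (snd (snd (snd p))))"
      unfolding cov_def by (intro computable_rat_intros computable_halts)
    show "coded_open W n \<in> sets lborel" for n
    proof -
      have "open (coded_open W n)" unfolding coded_open_def by auto
      then show ?thesis by simp
    qed
    show "{of_rat p..of_rat q} \<subseteq> coded_open W n" if cov: "cov n p q s" for n p q s
    proof -
      obtain i j c where "halts e (prod_encode (n, prod_encode (i, j))) c"
        and *: "nat_to_rat_surj i < p" "q < nat_to_rat_surj j"
        using cov unfolding cov_def by blast
      then have "prod_encode (n, prod_encode (i, j)) \<in> W" using e by blast
      then have "{rat_real i<..<rat_real j} \<subseteq> coded_open W n" unfolding coded_open_def by blast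
      moreover have "rat_real i < of_rat p" "of_rat q < rat_real j"
        using * by (simp_all add: of_rat_less)
      ultimately show ?thesis by force
    qed
    show "\<exists>x<\<alpha>. \<exists>s0. \<forall>s\<ge>s0. \<forall>p q. x < of_rat p \<longrightarrow> of_rat q < \<alpha> \<longrightarrow> cov n p q s" for n
    proof -
      \<comment> \<open>An interval of the component that contains \<alpha>; its left end serves as
        \<open>x\<close>, and it covers everything from there up to \<alpha>.\<close>
      obtain i j where ij: "prod_encode (n, prod_encode (i, j)) \<in> W" "rat_real i < \<alpha>" "\<alpha> < rat_real j"
        using \<alpha>[of n] unfolding coded_open_def by auto
      then obtain c where c: "halts e (prod_encode (n, prod_encode (i, j))) c" using e by blast
      have "cov n p q s" if "Suc (i + j + c) \<le> s" "rat_real i < of_rat p" "of_rat q < \<alpha>" for p q s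
      proof -
        have "real_of_rat q < rat_real j" using that(3) ij(3) by simp
        then have "nat_to_rat_surj i < p" "q < nat_to_rat_surj j"
          using that(2) by (simp_all add: of_rat_less)
        moreover have "i < s" "j < s" "c < s" using that(1) by auto
        ultimately show ?thesis using c unfolding cov_def by blast
      qed
      with ij(2) show ?thesis by blast
    qed
  qed (use a assms(2) measure in auto)
  show ?thesis
    using left_ce_\<beta> not_random_\<beta> not_left_ce not_right_ce by blast
qed

end
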